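(* Let $n\ge2$. For all $w,v\in S_n$, $$c(w;v)=\psi\bigl(w*\mathfrak S_v(\theta)\bigr),$$ where $c(w;v)$ is the coefficient of $[X(v)]$ in the Chern--Schwartz--MacPherson class $c_{SM}(X(w)^\circ)=\sum_{v\in S_n}c(w;v)[X(v)]$ of the Schubert cell $X(w)^\circ$ in the type $A$ flag variety, $\mathfrak S_v(\theta)\in FK_n$ is the Schubert polynomial evaluated at the Dunkl elements, $*$ is the extended Bruhat action of $FK_n$ on $\mathbb Z[S_n]$, and $\psi:\mathbb Z[S_n]\to\mathbb Z$ is the ring homomorphism with $\psi(u)=1$ for all $u\in S_n$.
   Context: Fomin--Kirillov algebra: $FK_n$ is the associative unital algebra generated by $[ij]$, $1\le i<j\le n$, with the convention $[ji]=-[ij]$, subject to: $[ij]^2=0$; $[ij][kl]=[kl][ij]$ for distinct $i,j,k,l$; $[ij][jk]=[jk][ik]+[ik][ij]$ and $[jk][ij]=[ik][jk]+[ij][ik]$ for distinct $i,j,k$. The Dunkl elements are $\theta_i=\sum_{j\ne i}[ij]$, $1\le i\le n$; they commute pairwise. The extended Bruhat action is the right action of $FK_n$ on $\mathbb Z[S_n]$ given, for $i<j$ and $w\in S_n$, by $w*[ij]=wt_{ij}$ if $\ell(wt_{ij})<\ell(w)$ and $w*[ij]=0$ otherwise, where $t_{ij}$ is the transposition $(i\ j)$ and $\ell$ is the length function; so $w*(ab)=(w*a)*b$. Schubert polynomials: $\mathfrak S_{w_0}=x_1^{n-1}x_2^{n-2}\cdots x_{n-1}$ for the longest element $w_0\in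 S_n$, and $\mathfrak S_{ws_k}=\partial_k\mathfrak S_w$ if $\ell(ws_k)<\ell(w)$, where $\partial_kf=(f-s_kf)/(x_k-x_{k+1})$ and $s_k=(k\ k{+}1)$. $\mathfrak S_v(\theta)$ is obtained by substituting $x_i\mapsto\theta_i$. CSM classes: let $X=SL_n(\mathbb C)/B$, with $B$ the upper triangular matrices, $X(w)^\circ=BwB/B$ and $X(w)=\overline{BwB/B}$. The classes $[X(w)]$, $w\in S_n$, form a basis of $H_*(X)$. The CSM class is $c_{SM}(X(w)^\circ)=c_*(\mathbb 1_{X(w)^\circ})\in H_*(X)$, with $c_*$ MacPherson's natural transformation from constructible functions to homology. It is known (Aluffi--Mihalcea) that these classes are determined by $c_{SM}(X(e)^\circ)=[X(e)]$ and $T_k(c_{SM}(X(w)^\circ))=c_{SM}(X(ws_k)^\circ)$ for all $w\in S_n$, $1\le k\le n-1$, where $T_k=\partial_k-s_k$ on $H_*(X)$; here $\partial_k[X(w)]=[X(ws_k)]$ if $\ell(ws_k)>\ell(w)$ and $0$ otherwise, $s_k=\mathrm{id}-c_1(\mathcal L_{\alpha_k})\partial_k$, and $c_1(\mathcal L_\lambda)\cdot[X(w)]=\sum_\beta\langle\lambda,\beta^\vee\rangle[X(ws_\beta)]$, summed over positive roots $\beta$ with $\ell(ws_\beta)=\ell(w)-1$. The simple roots are $\alpha_k=\varepsilon_k-\varepsilon_{k+1}$, and for $\beta=\varepsilon_a-\varepsilon_b$ with $a<b$, $s_\beta=t_{ab}$. *)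

theory Defs
  imports
    "HOL-Library.Poly_Mapping"
    "HOL-Combinatorics.Permutations"
    "HOL-Algebra.QuotRing"
begin

section \<open>The symmetric group\<close>

text \<open>
  Elements of \<open>S\<^sub>n\<close> are the functions \<open>w\<close> with \<open>w permutes {1..n}\<close>; the product \<open>w t\<close> is
  \<open>w \<circ> t\<close>. The Coxeter length of a permutation is its number of inversions.
\<close>

definition perm_length :: "nat \<Rightarrow> (nat \<Rightarrow> nat) \<Rightarrow> nat" where
  "perm_length n w = card {(i, j). 1 \<le> i \<and> i < j \<and> j \<le> n \<and> w j < w i}"

definition longest_perm :: "nat \<Rightarrow> nat \<Rightarrow> nat" where
  "longest_perm n = (\<lambda>i. if i \<in> {1..n} then n + 1 - i else i)"

text \<open>
  The free abelian group on a set is rendered as in \<^theory>\<open>HOL-Library.Poly_Mapping\<close>: finitely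
  supported functions \<open>'a \<Rightarrow>\<^sub>0 int\<close>, with basis \<open>frag_of\<close> and linear extension \<open>frag_extend\<close>. This
  serves for \<open>\<int>[S\<^sub>n]\<close>, for the homology of the flag variety, for polynomials and for the free
  algebra.
\<close>

definition psi :: "((nat \<Rightarrow> nat) \<Rightarrow>\<^sub>0 int) \<Rightarrow> int" where
  "psi x = (\<Sum>u\<in>Poly_Mapping.keys x. Poly_Mapping.lookup x u)"

text \<open>\<open>psi\<close> is the ring homomorphism on the group ring that sends every permutation to 1:\<close>

definition group_ring_mult ::
    "((nat \<Rightarrow> nat) \<Rightarrow>\<^sub>0 int) \<Rightarrow> ((nat \<Rightarrow> nat) \<Rightarrow>\<^sub>0 int) \<Rightarrow> ((nat \<Rightarrow> nat) \<Rightarrow>\<^sub>0 int)" where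
  "group_ring_mult x y = frag_extend (\<lambda>u. frag_extend (\<lambda>v. frag_of (u \<circ> v)) y) x"

lemma psi_of [simp]: "psi (frag_of u) = 1"
  by (simp add: psi_def)

lemma psi_superset:
  "finite A \<Longrightarrow> Poly_Mapping.keys x \<subseteq> A \<Longrightarrow> psi x = (\<Sum>u\<in>A. Poly_Mapping.lookup x u)"
  unfolding psi_def by (intro sum.mono_neutral_left) (auto simp: in_keys_iff)

lemma psi_zero [simp]: "psi 0 = 0"
  by (simp add: psi_def)

lemma psi_add: "psi (x + y) = psi x + psi y"
proof -
  let ?A = "Poly_Mapping.keys x \<union> Poly_Mapping.keys y"
  have "psi (x + y) = (\<Sum>u\<in>?A. Poly_Mapping.lookup (x + y) u)"
    by (intro psi_superset) (simp_all add: Poly_Mapping.keys_add)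
  also have "\<dots> = psi x + psi y"
    by (simp add: lookup_add sum.distrib psi_superset [where A = ?A and x = x]
        psi_superset [where A = ?A and x = y])
  finally show ?thesis .
qed

lemma psi_cmul: "psi (frag_cmul c x) = c * psi x"
  by (subst psi_superset [where A = "Poly_Mapping.keys x"])
     (auto simp: psi_def sum_distrib_left keys_cmul)

lemma psi_sum: "psi (\<Sum>i\<in>I. f i) = (\<Sum>i\<in>I. psi (f i))"
  by (induction I rule: infinite_finite_induct) (auto simp: psi_add)

lemma psi_extend:
  "psi (frag_extend f x) = (\<Sum>u\<in>Poly_Mapping.keys x. Poly_Mapping.lookup x u * psi (f u))"
  by (simp add: frag_extend_def psi_sum psi_cmul)

lemma psi_mult: "psi (group_ring_mult x y) = psi x * psi y"
proof -
  have "psi (frag_extend (\<lambda>v. frag_of (u \<circ> v)) y) = psi y" for u :: "nat \<Rightarrow> nat"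
    by (simp add: psi_extend) (simp add: psi_def)
  then show ?thesis
    by (simp add: group_ring_mult_def psi_extend sum_distrib_right [symmetric])
       (simp add: psi_def)
qed

section \<open>The Fomin--Kirillov algebra\<close>

text \<open>
  A generator \<open>[ij]\<close> with \<open>i < j\<close> is the pair \<open>(i, j)\<close>. Words form the free monoid, written
  additively so that the convolution product of \<^theory>\<open>HOL-Library.Poly_Mapping\<close> makes
  \<open>fk_word \<Rightarrow>\<^sub>0 int\<close> the free associative unital ring on the letters.
\<close>

datatype fk_word = FK_Word (letters: "(nat \<times> nat) list")

instantiation fk_word :: monoid_add
begin

definition zero_fk_word :: fk_word where
  "0 = FK_Word []"

definition plus_fk_word :: "fk_word \<Rightarrow> fk_word \<Rightarrow> fk_word" where
  "u + v = FK_Word (letters u @ letters v)"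

instance
  by standard (auto simp: zero_fk_word_def plus_fk_word_def)

end

definition fk_letters :: "nat \<Rightarrow> (nat \<times> nat) set" where
  "fk_letters n = {(i, j). 1 \<le> i \<and> i < j \<and> j \<le> n}"

definition free_ring :: "nat \<Rightarrow> (fk_word \<Rightarrow>\<^sub>0 int) ring" where
  "free_ring n =
     \<lparr>carrier = {a. \<forall>u \<in> Poly_Mapping.keys a. set (letters u) \<subseteq> fk_letters n},
      mult = (*), one = 1, zero = 0, add = (+)\<rparr>"

definition free_gen :: "nat \<Rightarrow> nat \<Rightarrow> (fk_word \<Rightarrow>\<^sub>0 int)" where
  "free_gen i j =
     (if i < j then frag_of (FK_Word [(i, j)]) else - frag_of (FK_Word [(j, i)]))"

definition fk_relators :: "nat \<Rightarrow> (fk_word \<Rightarrow>\<^sub>0 int) set" where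
  "fk_relators n =
     {free_gen i j * free_gen i j | i j. i \<in> {1..n} \<and> j \<in> {1..n} \<and> i < j} \<union>
     {free_gen i j * free_gen k l - free_gen k l * free_gen i j | i j k l.
        {i, j, k, l} \<subseteq> {1..n} \<and> distinct [i, j, k, l]} \<union>
     {free_gen i j * free_gen j k - (free_gen j k * free_gen i k + free_gen i k * free_gen i j)
        | i j k. {i, j, k} \<subseteq> {1..n} \<and> distinct [i, j, k]} \<union>
     {free_gen j k * free_gen i j - (free_gen i k * free_gen j k + free_gen i j * free_gen i k)
        | i j k. {i, j, k} \<subseteq> {1..n} \<and> distinct [i, j, k]}"

definition fk_ideal :: "nat \<Rightarrow> (fk_word \<Rightarrow>\<^sub>0 int) set" where
  "fk_ideal n = Idl\<^bsub>free_ring n\<^esub> (fk_relators n)"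

definition FK :: "nat \<Rightarrow> (fk_word \<Rightarrow>\<^sub>0 int) set ring" where
  "FK n = free_ring n Quot fk_ideal n"

definition fk_gen :: "nat \<Rightarrow> nat \<Rightarrow> nat \<Rightarrow> (fk_word \<Rightarrow>\<^sub>0 int) set" where
  "fk_gen n i j = fk_ideal n +>\<^bsub>free_ring n\<^esub> free_gen i j"

definition dunkl :: "nat \<Rightarrow> nat \<Rightarrow> (fk_word \<Rightarrow>\<^sub>0 int) set" where
  "dunkl n i = (\<Oplus>\<^bsub>FK n\<^esub>j \<in> {1..n} - {i}. fk_gen n i j)"

lemma ring_free_ring: "ring (free_ring n)"
proof -
  let ?C = "carrier (free_ring n)"
  have add: "a + b \<in> ?C" if "a \<in> ?C" "b \<in> ?C" for a b
    using that Poly_Mapping.keys_add [of a b] by (fastforce simp: free_ring_def)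
  have mult: "a * b \<in> ?C" if "a \<in> ?C" "b \<in> ?C" for a b
    using that keys_mult [of a b] by (fastforce simp: free_ring_def plus_fk_word_def)
  have neg: "- a \<in> ?C" if "a \<in> ?C" for a
    using that by (simp add: free_ring_def)
  have one: "1 \<in> ?C"
    by (auto simp: free_ring_def zero_fk_word_def)
  have sel: "mult (free_ring n) = (*)" "add (free_ring n) = (+)"
    "one (free_ring n) = 1" "zero (free_ring n) = 0"
    by (simp_all add: free_ring_def)
  have zero: "0 \<in> ?C"
    by (simp add: free_ring_def)
  have inverse: "\<exists>b\<in>?C. a + b = 0" if "a \<in> ?C" for a
    using neg [OF that] by (intro bexI [of _ "- a"]) simp_all
  show ?thesis
  proof (rule ringI)
    show "abelian_group (free_ring n)"
      by (rule abelian_groupI) (simp_all add: sel add zero inverse ac_simps)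
    show "monoid (free_ring n)"
      by (rule monoidI) (simp_all add: sel mult one mult.assoc)
  qed (simp_all add: sel distrib_left distrib_right)
qed

text \<open>
  The extended Bruhat action: on a basis element by a generator, then by a word (from left to right,
  as it is a right action), then by the free ring, and finally by the quotient \<open>FK n\<close>, where an
  element is a coset all of whose members act in the same way.
\<close>

definition bruhat_letter ::
    "nat \<Rightarrow> ((nat \<Rightarrow> nat) \<Rightarrow>\<^sub>0 int) \<Rightarrow> nat \<times> nat \<Rightarrow> ((nat \<Rightarrow> nat) \<Rightarrow>\<^sub>0 int)" where
  "bruhat_letter n x = (\<lambda>(i, j). frag_extend (\<lambda>w.
     let w' = w \<circ> transpose i j
     in if perm_length n w' < perm_length n w then frag_of w' else 0) x)"

definition bruhat_free ::
    "nat \<Rightarrow> ((nat \<Rightarrow> nat) \<Rightarrow>\<^sub>0 int) \<Rightarrow> (fk_word \<Rightarrow>\<^sub>0 int) \<Rightarrow> ((nat \<Rightarrow> nat) \<Rightarrow>\<^sub>0 int)" where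
  "bruhat_free n x a = frag_extend (\<lambda>u. foldl (bruhat_letter n) x (letters u)) a"

definition bruhat_act ::
    "nat \<Rightarrow> ((nat \<Rightarrow> nat) \<Rightarrow>\<^sub>0 int) \<Rightarrow> (fk_word \<Rightarrow>\<^sub>0 int) set \<Rightarrow> ((nat \<Rightarrow> nat) \<Rightarrow>\<^sub>0 int)" where
  "bruhat_act n x A = the_elem (bruhat_free n x ` A)"

section \<open>Schubert polynomials\<close>

text \<open>
  Integer polynomials in \<open>x\<^sub>1, x\<^sub>2, \<dots>\<close> are finitely supported functions from exponent vectors to
  \<open>int\<close>.
\<close>

type_synonym ipoly = "(nat \<Rightarrow>\<^sub>0 nat) \<Rightarrow>\<^sub>0 int"

definition var :: "nat \<Rightarrow> ipoly" where
  "var i = frag_of (Poly_Mapping.single i 1)"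

definition swap_vars :: "nat \<Rightarrow> ipoly \<Rightarrow> ipoly" where
  "swap_vars k = frag_extend (\<lambda>m. frag_of (Poly_Mapping.map_key (transpose k (Suc k)) m))"

text \<open>The polynomials form an integral domain, so the quotient is unique.\<close>

definition divided_diff :: "nat \<Rightarrow> ipoly \<Rightarrow> ipoly" where
  "divided_diff k f = (THE g. g * (var k - var (Suc k)) = f - swap_vars k f)"

inductive is_schubert :: "nat \<Rightarrow> (nat \<Rightarrow> nat) \<Rightarrow> ipoly \<Rightarrow> bool" for n :: nat where
  longest: "is_schubert n (longest_perm n) (\<Prod>i\<in>{1..<n}. var i ^ (n - i))"
| descend: "is_schubert n w f \<Longrightarrow> k \<in> {1..<n} \<Longrightarrow>
    perm_length n (w \<circ> transpose k (Suc k)) < perm_length n w \<Longrightarrow>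
    is_schubert n (w \<circ> transpose k (Suc k)) (divided_diff k f)"

definition schubert :: "nat \<Rightarrow> (nat \<Rightarrow> nat) \<Rightarrow> ipoly" where
  "schubert n w = (THE f. is_schubert n w f)"

text \<open>
  Substitution of ring elements for the variables \<open>x\<^sub>1, \<dots>, x\<^sub>n\<close>. The ring need not be commutative,
  so the factors of a monomial are multiplied in increasing order of the index; for pairwise
  commuting elements, such as the Dunkl elements, the order is irrelevant.
\<close>

definition eval_monom :: "('a, 'b) ring_scheme \<Rightarrow> nat \<Rightarrow> (nat \<Rightarrow> 'a) \<Rightarrow> (nat \<Rightarrow>\<^sub>0 nat) \<Rightarrow> 'a" where
  "eval_monom R n \<theta> m =
     foldr (\<lambda>i a. (\<theta> i [^]\<^bsub>R\<^esub> Poly_Mapping.lookup m i) \<otimes>\<^bsub>R\<^esub> a) [1..<Suc n] \<one>\<^bsub>R\<^esub>"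

definition eval_poly :: "('a, 'b) ring_scheme \<Rightarrow> nat \<Rightarrow> (nat \<Rightarrow> 'a) \<Rightarrow> ipoly \<Rightarrow> 'a" where
  "eval_poly R n \<theta> f =
     (\<Oplus>\<^bsub>R\<^esub>m \<in> Poly_Mapping.keys f. [Poly_Mapping.lookup f m] \<cdot>\<^bsub>R\<^esub> eval_monom R n \<theta> m)"

section \<open>CSM classes of Schubert cells\<close>

text \<open>
  \<open>H\<^sub>*(X)\<close> for the flag variety \<open>X\<close> of \<open>SL\<^sub>n(\<complex>)\<close> is the free abelian group on the Schubert classes,
  with \<open>frag_of w\<close> standing for \<open>[X(w)]\<close>. The CSM classes of the Schubert cells are given by the
  Aluffi--Mihalcea recursion for the operators \<open>T\<^sub>k = \<partial>\<^sub>k - s\<^sub>k\<close>, which determines them. A weight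
  \<open>\<mu> = \<Sum>\<^sub>i \<mu>\<^sub>i \<epsilon>\<^sub>i\<close> is given by its coordinates, so that \<open>\<langle>\<mu>, \<beta>\<^sup>\<or>\<rangle> = \<mu>\<^sub>a - \<mu>\<^sub>b\<close> for
  \<open>\<beta> = \<epsilon>\<^sub>a - \<epsilon>\<^sub>b\<close>.
\<close>

type_synonym homology = "(nat \<Rightarrow> nat) \<Rightarrow>\<^sub>0 int"

definition simple_root :: "nat \<Rightarrow> nat \<Rightarrow> int" where
  "simple_root k = (\<lambda>i. (if i = k then 1 else 0) - (if i = Suc k then 1 else 0))"

definition chern_cap :: "nat \<Rightarrow> (nat \<Rightarrow> int) \<Rightarrow> homology \<Rightarrow> homology" where
  "chern_cap n \<mu> = frag_extend (\<lambda>w.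
     \<Sum>(a, b) \<in> {(a, b). 1 \<le> a \<and> a < b \<and> b \<le> n \<and>
                     perm_length n (w \<circ> transpose a b) + 1 = perm_length n w}.
       frag_cmul (\<mu> a - \<mu> b) (frag_of (w \<circ> transpose a b)))"

definition bgg :: "nat \<Rightarrow> nat \<Rightarrow> homology \<Rightarrow> homology" where
  "bgg n k = frag_extend (\<lambda>w.
     let w' = w \<circ> transpose k (Suc k)
     in if perm_length n w' > perm_length n w then frag_of w' else 0)"

definition refl_op :: "nat \<Rightarrow> nat \<Rightarrow> homology \<Rightarrow> homology" where
  "refl_op n k x = x - chern_cap n (simple_root k) (bgg n k x)"

definition dl_op :: "nat \<Rightarrow> nat \<Rightarrow> homology \<Rightarrow> homology" where
  "dl_op n k x = bgg n k x - refl_op n k x"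

inductive is_csm :: "nat \<Rightarrow> (nat \<Rightarrow> nat) \<Rightarrow> homology \<Rightarrow> bool" for n :: nat where
  point: "is_csm n id (frag_of id)"
| step: "is_csm n w x \<Longrightarrow> k \<in> {1..<n} \<Longrightarrow> is_csm n (w \<circ> transpose k (Suc k)) (dl_op n k x)"

definition csm :: "nat \<Rightarrow> (nat \<Rightarrow> nat) \<Rightarrow> homology" where
  "csm n w = (THE x. is_csm n w x)"

end

theory Submission
  imports Defs
begin

text \<open>
  Let \<open>D\<^sub>i\<close> be the operator of the Dunkl element \<open>\<theta>\<^sub>i\<close> on \<open>\<int>[S\<^sub>n]\<close> and \<open>R\<^sub>k\<close> right multiplication
  by \<open>s\<^sub>k\<close>. Then \<open>D\<^sub>i R\<^sub>k = R\<^sub>k D\<^bsub>s\<^sub>k(i)\<^esub> + \<langle>\<epsilon>\<^sub>i, \<alpha>\<^sub>k\<^sup>\<or>\<rangle>\<close>: only the transposition \<open>s\<^sub>k\<close> itself is treated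
  differently before and after multiplication by \<open>s\<^sub>k\<close>. Since the \<open>D\<^sub>i\<close> kill the identity, this gives
  their commutativity and, for every polynomial \<open>f\<close>,
  \<open>f(D) R\<^sub>k = R\<^sub>k (s\<^sub>k f)(D) + (\<partial>\<^sub>k f)(D)\<close>, so that
  \<open>\<psi>(w s\<^sub>k * f(\<theta>)) = \<psi>(w * (s\<^sub>k f + \<partial>\<^sub>k f)(\<theta>))\<close>.

  Keeping only the terms that lower the length by one turns \<open>D\<^sub>i\<close> into the Chevalley operator
  \<open>N\<^sub>i\<close>, \<open>R\<^sub>k\<close> into the homological \<open>\<partial>\<^sub>k\<close>, and the relation into that of the nil-Hecke algebra.
  Hence the pairing of \<open>f\<close> with \<open>x\<close>, the coefficient of \<open>[X(e)]\<close> in \<open>f(N) x\<close>, makes the two operators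
  \<open>\<partial>\<^sub>k\<close> adjoint, Schubert polynomials dual to Schubert classes, and \<open>s\<^sub>k + \<partial>\<^sub>k\<close> adjoint to \<open>T\<^sub>k\<close>. The
  functionals \<open>\<psi>(w * f(\<theta>))\<close> and the pairing of \<open>f\<close> with the CSM class of \<open>w\<close> thus satisfy the same
  recursion in \<open>w\<close>.
\<close>

section \<open>Lengths of permutations\<close>

definition inversions :: "nat \<Rightarrow> (nat \<Rightarrow> nat) \<Rightarrow> (nat \<times> nat) set" where
  "inversions n w = {(i, j). 1 \<le> i \<and> i < j \<and> j \<le> n \<and> w j < w i}"

lemma perm_length_inversions: "perm_length n w = card (inversions n w)"
  by (simp add: perm_length_def inversions_def)

lemma finite_inversions [simp]: "finite (inversions n w)"
  by (rule finite_subset [of _ "{1..n} \<times> {1..n}"]) (auto simp: inversions_def)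

text \<open>An inversion of \<open>w t\<close> becomes one of \<open>w\<close> by applying \<open>t\<close> to both positions, unless
  \<open>t\<close> reverses their order, in which case the pair itself is an inversion of \<open>w\<close>.\<close>

definition inversion_map :: "nat \<Rightarrow> nat \<Rightarrow> nat \<times> nat \<Rightarrow> nat \<times> nat" where
  "inversion_map a b = (\<lambda>(i, j). if transpose a b i < transpose a b j
     then (transpose a b i, transpose a b j) else (i, j))"

text \<open>On increasing pairs the map is its own inverse: a second application restores both
  positions, and a reversed pair is left alone.\<close>

lemma inj_inversion_map: "inj_on (inversion_map a b) {(i, j). i < j}"
  by (rule inj_on_inverseI [where g = "inversion_map a b"])
    (auto simp: inversion_map_def)

lemma transpose_less_range:
  fixes a b :: nat
  assumes "1 \<le> a" "a < b" "b \<le> n" "1 \<le> i" "i \<le> n"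
  shows "1 \<le> transpose a b i" "transpose a b i \<le> n"
  using assms by (auto simp: transpose_def)

text \<open>Missing \<open>(a, b)\<close> is what makes the length drop strictly: that pair could
  only come from \<open>(b, a)\<close>, which is not increasing, or from itself, which is no
  inversion of \<open>w \<circ> transpose a b\<close>.\<close>

lemma inversion_map_image:
  assumes ab: "1 \<le> a" "a < b" "b \<le> n" and w: "inj w" "w b < w a"
  shows "inversion_map a b ` inversions n (w \<circ> transpose a b) \<subseteq> inversions n w - {(a, b)}"
proof (rule image_subsetI, rule prod.exhaust)
  fix p i j assume "p \<in> inversions n (w \<circ> transpose a b)" and p: "p = (i, j)"
  then have ij: "(i, j) \<in> inversions n (w \<circ> transpose a b)" by simp
  show "inversion_map a b p \<in> inversions n w - {(a, b)}"
  proof (cases "transpose a b i < transpose a b j")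
    case True
    then show ?thesis
      using ij transpose_less_range [OF ab, of i] transpose_less_range [OF ab, of j] ab
      by (auto simp: p inversion_map_def inversions_def transpose_eq_iff)
  next
    case False
    \<comment> \<open>The pair shares an end with \<open>(a, b)\<close>. For \<open>i = a\<close>
      its inversion reads \<open>w j < w b\<close>, for \<open>j = b\<close> it reads
      \<open>w a < w i\<close>; with \<open>w b < w a\<close> both give an inversion of
      \<open>w\<close>, and \<open>(a, b)\<close> itself is excluded.\<close>
    then have "i = a \<or> j = b"
      using ij ab by (auto simp: inversions_def transpose_def split: if_splits)
    with False show ?thesis
      using ij ab w by (auto simp: p inversion_map_def inversions_def transpose_def split: if_splits)
  qed
qed

lemma perm_length_transpose_less:
  assumes "1 \<le> a" "a < b" "b \<le> n" "inj w" "w b < w a"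
  shows "perm_length n (w \<circ> transpose a b) < perm_length n w"
proof -
  let ?I = "inversions n (w \<circ> transpose a b)"
  have "card ?I = card (inversion_map a b ` ?I)"
    by (intro card_image [symmetric] inj_on_subset [OF inj_inversion_map])
      (auto simp: inversions_def)
  also have "\<dots> \<le> card (inversions n w - {(a, b)})"
    by (intro card_mono inversion_map_image assms) simp
  also have "\<dots> < card (inversions n w)"
    using assms by (intro card_Diff1_less) (simp_all, simp add: inversions_def)
  finally show ?thesis by (simp add: perm_length_inversions)
qed

lemma perm_length_transpose_less_iff:
  assumes "1 \<le> a" "a < b" "b \<le> n" "inj w"
  shows "perm_length n (w \<circ> transpose a b) < perm_length n w \<longleftrightarrow> w b < w a"
proof
  assume l: "perm_length n (w \<circ> transpose a b) < perm_length n w"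
  show "w b < w a"
  proof (rule ccontr)
    assume "\<not> w b < w a"
    with assms have "w a < w b"
      by (metis injD linorder_neqE_nat nat_neq_iff)
    then have "perm_length n ((w \<circ> transpose a b) \<circ> transpose a b) < perm_length n (w \<circ> transpose a b)"
      using assms by (intro perm_length_transpose_less inj_compose) auto
    with l show False by (simp add: comp_assoc)
  qed
qed (use assms perm_length_transpose_less in blast)

text \<open>Now \<open>inversion_map\<close> reaches every inversion except \<open>(a, b)\<close>.
  Those at risk join \<open>a\<close> or \<open>b\<close> to a position \<open>c\<close> strictly
  between; they stay inversions after the swap because \<open>w c\<close> avoids the gap between
  \<open>w b\<close> and \<open>w a\<close>.\<close>

lemma perm_length_transpose_cover:
  assumes ab: "1 \<le> a" "a < b" "b \<le> n" and w: "inj w" "w b < w a"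
    and between: "\<And>c. a < c \<Longrightarrow> c < b \<Longrightarrow> w c \<le> w b \<or> w a \<le> w c"
  shows "perm_length n (w \<circ> transpose a b) + 1 = perm_length n w"
proof -
  let ?I = "inversions n (w \<circ> transpose a b)"
  have "inversions n w - {(a, b)} \<subseteq> inversion_map a b ` ?I"
  proof
    fix p assume p: "p \<in> inversions n w - {(a, b)}"
    obtain i j where ij: "p = (i, j)" by (cases p)
    have "inversion_map a b p \<in> ?I"
    proof (cases "transpose a b i < transpose a b j")
      case True
      then show ?thesis
        using p ij transpose_less_range [OF ab, of i] transpose_less_range [OF ab, of j]
        by (auto simp: inversion_map_def inversions_def)
    next
      case False
      then have *: "i = a \<and> a < j \<and> j < b \<or> j = b \<and> a < i \<and> i < b"
        using p ij ab by (auto simp: inversions_def transpose_def split: if_splits)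
      have "w c \<noteq> w a" "w c \<noteq> w b" if "a < c" "c < b" for c
        using that w(1) by (auto dest: injD)
      with * False between [of i] between [of j] show ?thesis
        using p ij ab w by (fastforce simp: inversion_map_def inversions_def transpose_def)
    qed
    moreover have "inversion_map a b (inversion_map a b p) = p"
      using p ij by (auto simp: inversion_map_def inversions_def)
    ultimately show "p \<in> inversion_map a b ` ?I" by (metis image_eqI)
  qed
  with inversion_map_image [OF ab w] have "inversion_map a b ` ?I = inversions n w - {(a, b)}"
    by blast
  moreover have "card (inversion_map a b ` ?I) = card ?I"
    by (intro card_image inj_on_subset [OF inj_inversion_map]) (auto simp: inversions_def)
  ultimately have "card ?I = card (inversions n w - {(a, b)})" by simp
  also have "\<dots> + 1 = card (inversions n w)"
    using ab w by (intro card_Suc_Diff1 [THEN trans [OF Suc_eq_plus1 [symmetric]]])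
      (simp_all, simp add: inversions_def)
  finally show ?thesis by (simp add: perm_length_inversions)
qed

text \<open>No position lies between \<open>k\<close> and \<open>Suc k\<close>, so the betweenness
  condition is vacuous; an ascent is a descent of the swapped permutation.\<close>

lemma perm_length_simple_cases:
  assumes "k \<in> {1..<n}" "inj w"
  obtains "w (Suc k) < w k" "perm_length n (w \<circ> transpose k (Suc k)) + 1 = perm_length n w"
  | "w k < w (Suc k)" "perm_length n (w \<circ> transpose k (Suc k)) = perm_length n w + 1"
proof -
  consider "w (Suc k) < w k" | "w k < w (Suc k)"
    using assms(2) by (metis injD linorder_neqE_nat n_not_Suc_n)
  then show ?thesis
  proof cases
    case 1
    then show ?thesis
      using assms by (intro that(1) perm_length_transpose_cover) auto
  next
    case 2
    let ?v = "w \<circ> transpose k (Suc k)"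
    have "perm_length n (?v \<circ> transpose k (Suc k)) + 1 = perm_length n ?v"
      using assms 2 by (intro perm_length_transpose_cover inj_compose) auto
    with 2 show ?thesis by (intro that(2)) (simp_all add: comp_assoc)
  qed
qed

section \<open>The identity and the longest element as extreme cases\<close>

lemma permutes_comp_transpose:
  assumes "w permutes {1..n}" "i \<in> {1..n}" "j \<in> {1..n}"
  shows "w \<circ> transpose i j permutes {1..n}"
  using assms by (intro permutes_compose permutes_swap_id)

lemma permutes_no_descent:
  assumes w: "w permutes {1..n}" and up: "\<And>k. k \<in> {1..<n} \<Longrightarrow> w k < w (Suc k)"
  shows "w = id"
proof -
  have range: "w i \<in> {1..n}" if "i \<in> {1..n}" for i
    using permutes_in_image [OF w] that by blast
  have ge: "i \<le> w i" if "i \<in> {1..n}" for i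
    using that
  proof (induction i)
    case (Suc i)
    show ?case
    proof (cases "i = 0")
      case True
      with Suc.prems range [of "Suc i"] show ?thesis by simp
    next
      case False
      with Suc up [of i] show ?thesis by auto
    qed
  qed simp
  \<comment> \<open>Mirror image of \<open>ge\<close>, running down from position
    \<open>n\<close>.\<close>
  have le: "w (n - d) \<le> n - d" if "d < n" for d
    using that
  proof (induction d)
    case 0
    with range [of n] show ?case by simp
  next
    case (Suc d)
    with up [of "n - Suc d"] have "w (n - Suc d) < w (n - d)" by (simp add: Suc_diff_Suc)
    with Suc show ?case by simp
  qed
  have "w i = i" for i
  proof (cases "i \<in> {1..n}")
    case True
    with ge [of i] le [of "n - i"] show ?thesis by auto
  qed (use w in \<open>simp add: permutes_not_in\<close>)
  then show ?thesis by auto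
qed

lemma longest_perm_permutes: "longest_perm n permutes {1..n}"
proof -
  have "bij_betw (longest_perm n) {1..n} {1..n}"
    by (rule bij_betw_byWitness [where f' = "longest_perm n"])
      (auto simp: longest_perm_def simp del: One_nat_def)
  then show ?thesis
    by (rule bij_imp_permutes) (simp only: longest_perm_def if_False)
qed

text \<open>Composing with the involution \<open>longest_perm n\<close> on the left reverses the
  order of the values and reduces this to \<open>permutes_no_descent\<close>.\<close>

lemma permutes_no_ascent:
  assumes w: "w permutes {1..n}" and down: "\<And>k. k \<in> {1..<n} \<Longrightarrow> w (Suc k) < w k"
  shows "w = longest_perm n"
proof -
  have "longest_perm n \<circ> w = id"
  proof (rule permutes_no_descent)
    show "longest_perm n \<circ> w permutes {1..n}"
      by (intro permutes_compose w longest_perm_permutes)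
    fix k assume k: "k \<in> {1..<n}"
    then have "w k \<in> {1..n}" "w (Suc k) \<in> {1..n}"
      using permutes_in_image [OF w] by (simp_all del: atLeastAtMost_iff) auto
    with down [OF k] show "(longest_perm n \<circ> w) k < (longest_perm n \<circ> w) (Suc k)"
      by (auto simp: longest_perm_def)
  qed
  then have "longest_perm n \<circ> (longest_perm n \<circ> w) = longest_perm n \<circ> id" by simp
  moreover have "longest_perm n \<circ> longest_perm n = id"
    by (rule ext) (auto simp: longest_perm_def)
  ultimately show ?thesis by (simp add: comp_assoc [symmetric])
qed

text \<open>The sum counts all pairs of positions, so at equality every pair, in particular every
  adjacent one, is inverted.\<close>

lemma perm_length_eq_max:
  assumes w: "w permutes {1..n}" and len: "perm_length n w = (\<Sum>i\<in>{1..<n}. n - i)"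
  shows "w = longest_perm n"
proof (rule permutes_no_ascent [OF w])
  let ?A = "SIGMA i:{1..<n}. {i<..n}"
  have "inversions n w \<subseteq> ?A" by (auto simp: inversions_def)
  moreover have "card ?A = (\<Sum>i\<in>{1..<n}. n - i)" by simp
  ultimately have "inversions n w = ?A"
    using len by (intro card_subset_eq) (auto simp: perm_length_inversions)
  moreover fix k assume "k \<in> {1..<n}"
  ultimately have "(k, Suc k) \<in> inversions n w" by auto
  then show "w (Suc k) < w k" by (simp add: inversions_def)
qed

lemma perm_length_le_max: "perm_length n w \<le> (\<Sum>i\<in>{1..<n}. n - i)"
proof -
  have "card (inversions n w) \<le> card (SIGMA i:{1..<n}. {i<..n})"
    by (rule card_mono) (auto simp: inversions_def)
  then show ?thesis by (simp add: perm_length_inversions)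
qed

lemma perm_length_id: "perm_length n id = 0"
  by (auto simp: perm_length_def card_eq_0_iff)

section \<open>Divided differences\<close>

lemma var_mult_frag_of: "var i * frag_of m = frag_of (m + Poly_Mapping.single i 1)"
  by (simp add: var_def mult_single add.commute)

lemma monomial_induct [case_names zero var]:
  fixes m :: "nat \<Rightarrow>\<^sub>0 nat"
  assumes zero: "P 0" and var: "\<And>m i. P m \<Longrightarrow> P (m + Poly_Mapping.single i 1)"
  shows "P m"
proof (induction "sum (Poly_Mapping.lookup m) (Poly_Mapping.keys m)" arbitrary: m)
  case 0
  then have "m = 0" by (simp add: in_keys_iff) (metis in_keys_iff lookup_zero poly_mapping_eqI)
  with zero show ?case by simp
next
  case (Suc d)
  then obtain i where i: "i \<in> Poly_Mapping.keys m"
    by fastforce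
  \<comment> \<open>Subtraction of exponents is truncated; since \<open>i\<close> occurs in
    \<open>m\<close>, adding the unit back restores \<open>m\<close>.\<close>
  define m' where "m' = m - Poly_Mapping.single i 1"
  have m: "m = m' + Poly_Mapping.single i 1"
    using i by (intro poly_mapping_eqI)
      (auto simp: m'_def lookup_add lookup_minus lookup_single when_def in_keys_iff)
  have "sum (Poly_Mapping.lookup m) (Poly_Mapping.keys m) =
      sum (Poly_Mapping.lookup m') (Poly_Mapping.keys m) + 1"
    using i by (subst m) (simp add: lookup_add sum.distrib lookup_single when_def)
  also have "sum (Poly_Mapping.lookup m') (Poly_Mapping.keys m) =
      sum (Poly_Mapping.lookup m') (Poly_Mapping.keys m')"
    by (rule sum.mono_neutral_right) (auto simp: in_keys_iff m'_def lookup_minus)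
  finally have "P m'" using Suc by simp
  then show ?case by (subst m) (rule var)
qed

lemma swap_vars_0 [simp]: "swap_vars k 0 = 0"
  and swap_vars_frag_of: "swap_vars k (frag_of m) = frag_of (Poly_Mapping.map_key (transpose k (Suc k)) m)"
  and swap_vars_diff: "swap_vars k (f - g) = swap_vars k f - swap_vars k g"
  by (simp_all add: swap_vars_def frag_extend_diff)

lemma lookup_map_key_transpose:
  "Poly_Mapping.lookup (Poly_Mapping.map_key (transpose a b) m) i = Poly_Mapping.lookup m (transpose a b i)"
  by (simp add: map_key.rep_eq)

lemma swap_vars_var_mult: "swap_vars k (var i * f) = var (transpose k (Suc k) i) * swap_vars k f"
proof (induction f rule: frag_induction [OF subset_UNIV])
  case (2 m)
  show ?case
    by (auto simp: var_mult_frag_of swap_vars_frag_of frag_of_eq lookup_map_key_transpose lookup_add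
      lookup_single when_def transpose_eq_iff intro!: poly_mapping_eqI)
qed (simp_all add: swap_vars_diff right_diff_distrib)

lemma var_diff_nonzero: "var k - var (Suc k) \<noteq> 0"
proof -
  have "Poly_Mapping.single k (1::nat) \<noteq> Poly_Mapping.single (Suc k) 1"
    by (metis lookup_single_eq lookup_single_not_eq n_not_Suc_n zero_neq_one)
  then show ?thesis by (simp add: var_def frag_of_eq)
qed

section \<open>Divided differences: uniqueness, existence and exponents\<close>

lemma divided_diff_eqI:
  assumes "g * (var k - var (Suc k)) = f - swap_vars k f"
  shows "divided_diff k f = g"
  unfolding divided_diff_def
  using assms var_diff_nonzero [of k] by (intro the_equality) (metis mult_right_cancel)+

text \<open>The geometric sum for \<open>x^p y^q - x^q y^p\<close> divided by \<open>x - y\<close>.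
  The bound on the exponents is recorded because it later keeps divided differences within the
  staircase.\<close>

lemma monomial_quotient:
  fixes M :: "nat \<Rightarrow>\<^sub>0 nat" and k p q :: nat
  defines "T \<equiv> \<lambda>i j. M + Poly_Mapping.single k i + Poly_Mapping.single (Suc k) j"
  shows "\<exists>g. g * (var k - var (Suc k)) = frag_of (T p q) - frag_of (T q p) \<and>
    Poly_Mapping.keys g \<subseteq> {T i j | i j. i < max p q \<and> j < max p q}"
proof -
  have up: "frag_of (T i j) * (var k - var (Suc k)) = frag_of (T (Suc i) j) - frag_of (T i (Suc j))" for i j
  proof -
    have "var k * frag_of (T i j) = frag_of (T (Suc i) j)"
      "var (Suc k) * frag_of (T i j) = frag_of (T i (Suc j))"
      by (auto simp: var_mult_frag_of T_def frag_of_eq lookup_add lookup_single when_def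
        intro!: poly_mapping_eqI)
    then show ?thesis by (simp add: right_diff_distrib mult.commute)
  qed
  \<comment> \<open>The case where the first exponent is not the smaller one; the other case follows
    by negating the quotient.\<close>
  have *: "\<exists>g. g * (var k - var (Suc k)) = frag_of (T (q + d) q) - frag_of (T q (q + d)) \<and>
    Poly_Mapping.keys g \<subseteq> {T i j | i j. i < q + d \<and> j < q + d}" for q d
  proof (intro exI conjI)
    let ?g = "\<Sum>r<d. frag_of (T (q + d - Suc r) (q + r))"
    have "?g * (var k - var (Suc k)) =
        (\<Sum>r<d. frag_of (T (q + d - r) (q + r)) - frag_of (T (q + d - Suc r) (q + Suc r)))"
      by (simp add: sum_distrib_right up Suc_diff_Suc)
    also have "\<dots> = frag_of (T (q + d) q) - frag_of (T q (q + d))"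
      by (subst sum_lessThan_telescope') simp
    finally show "?g * (var k - var (Suc k)) = frag_of (T (q + d) q) - frag_of (T q (q + d))" .
    show "Poly_Mapping.keys ?g \<subseteq> {T i j | i j. i < q + d \<and> j < q + d}"
      by (rule order_trans [OF keys_sum]) fastforce
  qed
  show ?thesis
  proof (cases "q \<le> p")
    case True
    with * [of q "p - q"] show ?thesis by (simp add: max_def)
  next
    case False
    with * [of p "q - p"] obtain g where
      "g * (var k - var (Suc k)) = frag_of (T q p) - frag_of (T p q)"
      "Poly_Mapping.keys g \<subseteq> {T i j | i j. i < q \<and> j < q}" by auto
    with False show ?thesis by (intro exI [of _ "- g"]) (simp add: max_def)
  qed
qed

text \<open>Chosen to admit every monomial that \<open>monomial_quotient\<close> may produce;
  \<open>M\<close> carries the exponents of the other variables.\<close>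

definition exponent_closed :: "nat \<Rightarrow> (nat \<Rightarrow>\<^sub>0 nat) set \<Rightarrow> bool" where
  "exponent_closed k S \<longleftrightarrow> (\<forall>M p q i j.
     Poly_Mapping.lookup M k = 0 \<longrightarrow> Poly_Mapping.lookup M (Suc k) = 0 \<longrightarrow>
     M + Poly_Mapping.single k p + Poly_Mapping.single (Suc k) q \<in> S \<longrightarrow>
     i < max p q \<longrightarrow> j < max p q \<longrightarrow>
     M + Poly_Mapping.single k i + Poly_Mapping.single (Suc k) j \<in> S)"

lemma quotient_exists:
  assumes "Poly_Mapping.keys f \<subseteq> S" "exponent_closed k S"
  shows "\<exists>g. g * (var k - var (Suc k)) = f - swap_vars k f \<and> Poly_Mapping.keys g \<subseteq> S"
  using assms(1)
proof (induction f rule: frag_induction)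
  case zero
  show ?case by (intro exI [of _ 0]) simp
next
  case (one m)
  define p q where "p = Poly_Mapping.lookup m k" and "q = Poly_Mapping.lookup m (Suc k)"
  define M where "M = m - Poly_Mapping.single k p - Poly_Mapping.single (Suc k) q"
  have m: "m = M + Poly_Mapping.single k p + Poly_Mapping.single (Suc k) q"
    by (rule poly_mapping_eqI)
      (auto simp: M_def p_def q_def lookup_add lookup_minus lookup_single when_def)
  have m': "Poly_Mapping.map_key (transpose k (Suc k)) m =
      M + Poly_Mapping.single k q + Poly_Mapping.single (Suc k) p"
    by (rule poly_mapping_eqI)
      (auto simp: M_def p_def q_def lookup_map_key_transpose transpose_def lookup_add lookup_minus
        lookup_single when_def)
  from monomial_quotient [of k M p q] obtain g where
    "g * (var k - var (Suc k)) = frag_of m - swap_vars k (frag_of m)"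
    "Poly_Mapping.keys g \<subseteq> {M + Poly_Mapping.single k i + Poly_Mapping.single (Suc k) j | i j.
      i < max p q \<and> j < max p q}"
    by (auto simp: swap_vars_frag_of m' simp flip: m)
  moreover have "Poly_Mapping.lookup M k = 0" "Poly_Mapping.lookup M (Suc k) = 0"
    by (simp_all add: M_def p_def q_def lookup_minus lookup_single)
  moreover from calculation one assms(2) m have "Poly_Mapping.keys g \<subseteq> S"
    unfolding exponent_closed_def by blast
  ultimately show ?case by blast
next
  case (diff a b)
  then obtain g h where
    "g * (var k - var (Suc k)) = a - swap_vars k a" "Poly_Mapping.keys g \<subseteq> S"
    "h * (var k - var (Suc k)) = b - swap_vars k b" "Poly_Mapping.keys h \<subseteq> S"
    by blast
  then show ?case
    using keys_diff [of g h]
    by (intro exI [of _ "g - h"]) (auto simp: left_diff_distrib swap_vars_diff)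
qed

lemma divided_diff_mult: "divided_diff k f * (var k - var (Suc k)) = f - swap_vars k f"
  using quotient_exists [of f UNIV k] divided_diff_eqI by (force simp: exponent_closed_def)

lemma keys_divided_diff:
  "Poly_Mapping.keys f \<subseteq> S \<Longrightarrow> exponent_closed k S \<Longrightarrow> Poly_Mapping.keys (divided_diff k f) \<subseteq> S"
  using quotient_exists [of f S k] divided_diff_eqI by force

lemma divided_diff_diff: "divided_diff k (f - g) = divided_diff k f - divided_diff k g"
  by (rule divided_diff_eqI) (simp add: left_diff_distrib divided_diff_mult swap_vars_diff)

lemma divided_diff_0 [simp]: "divided_diff k 0 = 0"
  by (rule divided_diff_eqI) simp

lemma swap_vars_one [simp]: "swap_vars k (frag_of 0) = frag_of 0"
  by (simp add: swap_vars_frag_of del: single_one)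

lemma divided_diff_one [simp]: "divided_diff k (frag_of 0) = 0"
  by (rule divided_diff_eqI) (simp del: single_one)

text \<open>Twisted Leibniz rule; \<open>simple_root k i\<close> is the divided difference of
  \<open>x_i\<close>.\<close>

lemma divided_diff_var_mult:
  "divided_diff k (var i * f) =
    var (transpose k (Suc k) i) * divided_diff k f + frag_cmul (simple_root k i) f"
proof (rule divided_diff_eqI)
  let ?\<alpha> = "var k - var (Suc k)" and ?s = "transpose k (Suc k)"
  have root: "frag_cmul (simple_root k i) f * ?\<alpha> = (var i - var (?s i)) * f"
    by (auto simp: simple_root_def transpose_def algebra_simps)
  have "(var (?s i) * divided_diff k f + frag_cmul (simple_root k i) f) * ?\<alpha> =
      var (?s i) * (divided_diff k f * ?\<alpha>) + frag_cmul (simple_root k i) f * ?\<alpha>"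
    by (simp only: distrib_right mult.assoc)
  also have "\<dots> = var i * f - swap_vars k (var i * f)"
    unfolding root divided_diff_mult swap_vars_var_mult by (simp add: algebra_simps)
  finally show "(var (?s i) * divided_diff k f + frag_cmul (simple_root k i) f) * ?\<alpha> =
      var i * f - swap_vars k (var i * f)" .
qed

text \<open>Exponents dominated by those of \<open>x_1^(n-1) ... x_(n-1)\<close>. Schubert
  polynomials have only such exponents, and the pairing with Schubert classes separates polynomials
  of this kind.\<close>

definition staircase :: "nat \<Rightarrow> (nat \<Rightarrow>\<^sub>0 nat) set" where
  "staircase n = {m. \<forall>i. Poly_Mapping.lookup m i \<le> (if i \<in> {1..n} then n - i else 0)}"

text \<open>The old exponents are at most \<open>n - k\<close> and \<open>n - Suc k\<close>. Being
  strictly below their maximum, both new ones are at most \<open>n - Suc k\<close>, which is what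
  position \<open>Suc k\<close> permits.\<close>

lemma exponent_closed_staircase:
  assumes "k \<in> {1..<n}"
  shows "exponent_closed k (staircase n)"
  unfolding exponent_closed_def
proof (intro allI impI)
  fix M :: "nat \<Rightarrow>\<^sub>0 nat" and p q i j
  assume M: "Poly_Mapping.lookup M k = 0" "Poly_Mapping.lookup M (Suc k) = 0"
    and ij: "i < max p q" "j < max p q"
    and "M + Poly_Mapping.single k p + Poly_Mapping.single (Suc k) q \<in> staircase n"
  then have m: "Poly_Mapping.lookup M a + (p when k = a) + (q when Suc k = a)
      \<le> (if a \<in> {1..n} then n - a else 0)" for a
    by (simp add: staircase_def lookup_add lookup_single)
  have "p \<le> n - k" "q \<le> n - Suc k"
    using m [of k] m [of "Suc k"] M assms by simp_all
  moreover have "Poly_Mapping.lookup M a \<le> (if a \<in> {1..n} then n - a else 0)" for a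
    using m [of a] by linarith
  ultimately have "Poly_Mapping.lookup M a + (i when k = a) + (j when Suc k = a)
      \<le> (if a \<in> {1..n} then n - a else 0)" for a
    using ij M assms by (cases "a = k"; cases "a = Suc k") auto
  then show "M + Poly_Mapping.single k i + Poly_Mapping.single (Suc k) j \<in> staircase n"
    by (simp add: staircase_def lookup_add lookup_single)
qed

section \<open>Operators satisfying the Hecke cross relations\<close>

declare One_nat_def [simp del]

text \<open>Differences are the chosen form of additivity because \<open>frag_induction\<close>
  builds elements from generators by differences.\<close>

lemma diff_imp_linear:
  fixes F :: "('a \<Rightarrow>\<^sub>0 int) \<Rightarrow> ('b \<Rightarrow>\<^sub>0 int)"
  assumes diff: "\<And>x y. F (x - y) = F x - F y"
  shows "F 0 = 0" "F (x + y) = F x + F y" "F (frag_cmul c x) = frag_cmul c (F x)"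
    "F (\<Sum>i\<in>I. g i) = (\<Sum>i\<in>I. F (g i))"
proof -
  show zero: "F 0 = 0"
    using diff [of 0 0] by simp
  have add: "F (x + y) = F x + F y" for x y
    using diff [of x "0 - y"] diff [of 0 y] zero by simp
  then show "F (x + y) = F x + F y" .
  show "F (frag_cmul c x) = frag_cmul c (F x)"
    by (induction c rule: int_induct [where k = 0])
      (simp_all add: zero add diff frag_cmul_distrib frag_cmul_diff_distrib)
  show "F (\<Sum>i\<in>I. g i) = (\<Sum>i\<in>I. F (g i))"
    by (induction I rule: infinite_finite_induct) (simp_all add: zero add)
qed

lemma frag_cmul_minus_right: "frag_cmul c (x - y) = frag_cmul c x - frag_cmul c y"
  by (rule poly_mapping_eqI) (simp add: lookup_minus right_diff_distrib)

lemma frag_extend_minus_fun: "frag_extend (\<lambda>m. F m - G m) f = frag_extend F f - frag_extend G f"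
  by (induction f rule: frag_induction [OF subset_UNIV]) (simp_all add: frag_extend_diff)

text \<open>Basis elements are arbitrary functions on \<open>nat\<close>; this singles out Z[S_n],
  where the length arguments apply.\<close>

definition supported :: "nat \<Rightarrow> ((nat \<Rightarrow> nat) \<Rightarrow>\<^sub>0 int) \<Rightarrow> bool" where
  "supported n x \<longleftrightarrow> (\<forall>w\<in>Poly_Mapping.keys x. w permutes {1..n})"

lemma supported_0 [simp]: "supported n 0"
  and supported_frag_of [simp]: "supported n (frag_of w) \<longleftrightarrow> w permutes {1..n}"
  and supported_cmul: "supported n x \<Longrightarrow> supported n (frag_cmul c x)"
  by (auto simp: supported_def)

lemma supported_diff: "supported n x \<Longrightarrow> supported n y \<Longrightarrow> supported n (x - y)"
  using keys_diff [of x y] by (auto simp: supported_def)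

lemma supported_add: "supported n x \<Longrightarrow> supported n y \<Longrightarrow> supported n (x + y)"
  using Poly_Mapping.keys_add [of x y] by (auto simp: supported_def)

lemma supported_sum: "(\<And>i. i \<in> I \<Longrightarrow> supported n (f i)) \<Longrightarrow> supported n (\<Sum>i\<in>I. f i)"
  by (induction I rule: infinite_finite_induct) (auto intro: supported_add)

lemma supported_induct [consumes 1, case_names zero perm diff]:
  assumes "supported n x" "P 0" "\<And>w. w permutes {1..n} \<Longrightarrow> P (frag_of w)"
    and "\<And>x y. supported n x \<Longrightarrow> supported n y \<Longrightarrow> P x \<Longrightarrow> P y \<Longrightarrow> P (x - y)"
  shows "P x"
proof -
  have "supported n x \<and> P x"
  proof (rule frag_induction [of x "{w. w permutes {1..n}}"])
    show "Poly_Mapping.keys x \<subseteq> {w. w permutes {1..n}}"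
      using assms(1) by (auto simp: supported_def)
  qed (use assms supported_diff in auto)
  then show ?thesis ..
qed

lemma supported_linear:
  assumes "supported n x" "\<And>x y. F (x - y) = F x - F y"
    and "\<And>w. w permutes {1..n} \<Longrightarrow> supported n (F (frag_of w))"
  shows "supported n (F x)"
  using assms(1)
  by (induction rule: supported_induct)
    (simp_all add: assms(2,3) diff_imp_linear(1) [of F] supported_diff)

text \<open>The operators stand for a right action, so \<open>A 1\<close> is applied first, like the
  leftmost factor in \<open>eval_monom\<close>. Variables outside \<open>{1..n}\<close> are set to
  1.\<close>

definition monom_op ::
    "nat \<Rightarrow> (nat \<Rightarrow> homology \<Rightarrow> homology) \<Rightarrow> (nat \<Rightarrow>\<^sub>0 nat) \<Rightarrow> homology \<Rightarrow> homology" where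
  "monom_op n A m x = foldl (\<lambda>y i. (A i ^^ Poly_Mapping.lookup m i) y) x [1..<Suc n]"

definition poly_op ::
    "nat \<Rightarrow> (nat \<Rightarrow> homology \<Rightarrow> homology) \<Rightarrow> ipoly \<Rightarrow> homology \<Rightarrow> homology" where
  "poly_op n A f x = frag_extend (\<lambda>m. monom_op n A m x) f"

lemma poly_op_0 [simp]: "poly_op n A 0 x = 0"
  and poly_op_frag_of: "poly_op n A (frag_of m) x = monom_op n A m x"
  and poly_op_diff: "poly_op n A (f - g) x = poly_op n A f x - poly_op n A g x"
  and poly_op_add: "poly_op n A (f + g) x = poly_op n A f x + poly_op n A g x"
  and poly_op_cmul: "poly_op n A (frag_cmul c f) x = frag_cmul c (poly_op n A f x)"
  by (simp_all add: poly_op_def frag_extend_diff frag_extend_add frag_extend_cmul)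

lemma poly_op_one: "poly_op n A (frag_of 0) x = x"
proof -
  have "foldl (\<lambda>y i. (A i ^^ Poly_Mapping.lookup (0 :: nat \<Rightarrow>\<^sub>0 nat) i) y) x is = x" for "is"
    by (induction "is") auto
  then show ?thesis by (simp only: poly_op_frag_of monom_op_def)
qed

lemma transpose_simple_mem: "i \<in> {1..n} \<Longrightarrow> k \<in> {1..<n} \<Longrightarrow> transpose k (Suc k) i \<in> {1..n}"
  by (auto simp: transpose_def)

text \<open>The relation \<open>cross_perm\<close> is that of the degenerate affine Hecke algebra or, for
  \<open>R k = \<partial>\<^sub>k\<close>, of the nil-Hecke algebra.\<close>

locale hecke_action =
  fixes n :: nat and A R :: "nat \<Rightarrow> homology \<Rightarrow> homology"
  assumes A_diff: "A i (x - y) = A i x - A i y"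
    and R_diff: "R k (x - y) = R k x - R k y"
    and A_perm: "w permutes {1..n} \<Longrightarrow> i \<in> {1..n} \<Longrightarrow> supported n (A i (frag_of w))"
    and R_perm: "w permutes {1..n} \<Longrightarrow> k \<in> {1..<n} \<Longrightarrow> supported n (R k (frag_of w))"
    and A_id: "i \<in> {1..n} \<Longrightarrow> A i (frag_of id) = 0"
    and cross_perm: "w permutes {1..n} \<Longrightarrow> i \<in> {1..n} \<Longrightarrow> k \<in> {1..<n} \<Longrightarrow>
      A i (R k (frag_of w)) =
      R k (A (transpose k (Suc k) i) (frag_of w)) + frag_cmul (simple_root k i) (frag_of w)"
    and generated: "w permutes {1..n} \<Longrightarrow> w \<noteq> id \<Longrightarrow>
      \<exists>k\<in>{1..<n}. \<exists>u. u permutes {1..n} \<and> perm_length n u < perm_length n w \<and>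
        frag_of w = R k (frag_of u)"
begin

section \<open>Commutation and polynomial calculus from the cross relation\<close>

lemmas A_linear = diff_imp_linear [of "A i" for i, OF A_diff]
lemmas R_linear = diff_imp_linear [of "R k" for k, OF R_diff]

lemma A_supported: "supported n x \<Longrightarrow> i \<in> {1..n} \<Longrightarrow> supported n (A i x)"
  by (rule supported_linear) (auto simp: A_diff A_perm)

lemma R_supported: "supported n x \<Longrightarrow> k \<in> {1..<n} \<Longrightarrow> supported n (R k x)"
  by (rule supported_linear) (auto simp: R_diff R_perm)

lemma cross:
  assumes "supported n x" "i \<in> {1..n}" "k \<in> {1..<n}"
  shows "A i (R k x) = R k (A (transpose k (Suc k) i) x) + frag_cmul (simple_root k i) x"
  using assms(1)
proof (induction rule: supported_induct)
  case (perm w)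
  with assms show ?case by (intro cross_perm)
qed (simp_all add: A_linear R_linear A_diff R_diff frag_cmul_minus_right)

text \<open>By \<open>generated\<close>, \<open>w\<close> arises by \<open>R k\<close> from a
  shorter \<open>u\<close>. Moving both operators past \<open>R k\<close> leaves a main term covered
  by the induction hypothesis and a correction symmetric in \<open>i\<close> and \<open>j\<close>.
  The base is the identity, killed by \<open>A_id\<close>.\<close>

lemma commute_perm:
  assumes "w permutes {1..n}" "i \<in> {1..n}" "j \<in> {1..n}"
  shows "A i (A j (frag_of w)) = A j (A i (frag_of w))"
  using assms
proof (induction "perm_length n w" arbitrary: w i j rule: less_induct)
  case less
  show ?case
  proof (cases "w = id")
    case True
    with less show ?thesis by (simp add: A_id A_linear)
  next
    case False
    from generated [OF less.prems(1) False] obtain k u where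
      k: "k \<in> {1..<n}" and u: "u permutes {1..n}" "perm_length n u < perm_length n w"
      and w: "frag_of w = R k (frag_of u)" by blast
    let ?s = "transpose k (Suc k)"
    have *: "A i (A j (R k (frag_of u))) = R k (A (?s i) (A (?s j) (frag_of u))) +
        (frag_cmul (simple_root k i) (A (?s j) (frag_of u)) +
         frag_cmul (simple_root k j) (A i (frag_of u)))"
      if "i \<in> {1..n}" "j \<in> {1..n}" for i j
      using that k u(1) transpose_simple_mem [OF that(1) k] transpose_simple_mem [OF that(2) k]
      by (simp add: cross A_supported A_linear R_linear add.assoc)
    \<comment> \<open>With \<open>c_i = simple_root k i\<close>, \<open>A_(s i)\<close> is
      \<open>A_i - c_i (A_k - A_(k+1))\<close>, so both sides equal
      \<open>c_i A_j + c_j A_i - c_i c_j (A_k - A_(k+1))\<close>.\<close>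
    have "frag_cmul (simple_root k i) (A (?s j) (frag_of u)) +
          frag_cmul (simple_root k j) (A i (frag_of u)) =
        frag_cmul (simple_root k j) (A (?s i) (frag_of u)) +
          frag_cmul (simple_root k i) (A j (frag_of u))"
      by (auto simp: simple_root_def transpose_def)
    then show ?thesis
      unfolding w using less.prems k u less.hyps
        transpose_simple_mem [OF less.prems(2) k] transpose_simple_mem [OF less.prems(3) k] by (simp add: *)
  qed
qed

lemma commute:
  assumes "supported n x" "i \<in> {1..n}" "j \<in> {1..n}"
  shows "A i (A j x) = A j (A i x)"
  using assms(1)
proof (induction rule: supported_induct)
  case (perm w)
  then show ?case using assms(2,3) by (rule commute_perm)
qed (simp_all add: A_linear A_diff)

lemma funpow_supported: "supported n x \<Longrightarrow> i \<in> {1..n} \<Longrightarrow> supported n ((A i ^^ p) x)"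
  by (induction p) (auto intro: A_supported)

lemma funpow_commute:
  "supported n x \<Longrightarrow> i \<in> {1..n} \<Longrightarrow> j \<in> {1..n} \<Longrightarrow> A i ((A j ^^ p) x) = (A j ^^ p) (A i x)"
proof (induction p)
  case (Suc p)
  with commute [OF funpow_supported, of x j i j p] show ?case by simp
qed simp

lemma funpow_diff: "(A i ^^ p) (x - y) = (A i ^^ p) x - (A i ^^ p) y"
  by (induction p) (auto simp: A_diff)

lemma monom_op_diff: "monom_op n A m (x - y) = monom_op n A m x - monom_op n A m y"
proof -
  have "foldl (\<lambda>y i. (A i ^^ Poly_Mapping.lookup m i) y) (x - y) is =
    foldl (\<lambda>y i. (A i ^^ Poly_Mapping.lookup m i) y) x is -
    foldl (\<lambda>y i. (A i ^^ Poly_Mapping.lookup m i) y) y is" for "is"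
    by (induction "is" arbitrary: x y) (auto simp: funpow_diff)
  then show ?thesis by (simp add: monom_op_def)
qed

lemma poly_op_diff_right: "poly_op n A f (x - y) = poly_op n A f x - poly_op n A f y"
  by (simp add: poly_op_def monom_op_diff frag_extend_minus_fun)

lemmas poly_op_linear_right = diff_imp_linear [of "poly_op n A f" for f, OF poly_op_diff_right]

text \<open>Commutativity lets the extra factor be applied first, whatever its place in the fixed
  order of the product.\<close>

lemma monom_op_var:
  assumes "supported n x" "i \<in> {1..n}"
  shows "monom_op n A (m + Poly_Mapping.single i 1) x = monom_op n A m (A i x)"
proof -
  let ?F = "\<lambda>m y i. (A i ^^ Poly_Mapping.lookup m i) y"
  \<comment> \<open>Generalised to any list of distinct indices: the extra factor moves to the front
    only if \<open>i\<close> is still to come.\<close>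
  have "foldl (?F (m + Poly_Mapping.single i 1)) x js =
      foldl (?F m) (if i \<in> set js then A i x else x) js"
    if "set js \<subseteq> {1..n}" "distinct js" "supported n x" for js x
    using that
  proof (induction js arbitrary: x)
    case (Cons j js)
    then have "supported n ((A j ^^ Poly_Mapping.lookup m j) x)"
      by (intro funpow_supported) auto
    moreover have "supported n ((A j ^^ Suc (Poly_Mapping.lookup m j)) x)"
      using Cons by (intro funpow_supported) auto
    moreover have "(A j ^^ (p + 1)) x = (A j ^^ p) (A j x)" for p
      by (metis Suc_eq_plus1 comp_apply funpow_Suc_right)
    ultimately show ?case
      using Cons assms(2)
      by (cases "i = j") (auto simp: lookup_add lookup_single funpow_commute funpow_swap1)
  qed simp
  moreover have "set [1..<Suc n] = {1..n}" by auto
  ultimately show ?thesis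
    using assms by (simp add: monom_op_def del: upt_Suc)
qed

lemma monom_op_var_outside:
  assumes "i \<notin> {1..n}"
  shows "monom_op n A (m + Poly_Mapping.single i 1) x = monom_op n A m x"
  unfolding monom_op_def using assms
  by (intro foldl_cong) (auto simp: lookup_add lookup_single)

lemma poly_op_var:
  assumes "supported n x" "i \<in> {1..n}"
  shows "poly_op n A (var i * f) x = poly_op n A f (A i x)"
  by (induction f rule: frag_induction [OF subset_UNIV])
    (simp_all only: assms mult_zero_right poly_op_0 var_mult_frag_of poly_op_frag_of monom_op_var
      right_diff_distrib poly_op_diff)

lemma poly_op_var_outside:
  assumes "i \<notin> {1..n}"
  shows "poly_op n A (var i * f) x = poly_op n A f x"
  by (induction f rule: frag_induction [OF subset_UNIV])
    (simp_all only: assms mult_zero_right poly_op_0 var_mult_frag_of poly_op_frag_of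
      monom_op_var_outside not_False_eq_True right_diff_distrib poly_op_diff)

text \<open>Monomials are built one variable at a time: \<open>cross\<close> on the operator side
  matches the Leibniz rule \<open>divided_diff_var_mult\<close> on the polynomial side.\<close>

theorem poly_op_cross:
  assumes x: "supported n x" and k: "k \<in> {1..<n}"
  shows "poly_op n A f (R k x) =
    R k (poly_op n A (swap_vars k f) x) + poly_op n A (divided_diff k f) x"
proof (induction f rule: frag_induction [OF subset_UNIV])
  case (2 m)
  show ?case
    using x
  proof (induction m arbitrary: x rule: monomial_induct)
    case zero
    show ?case by (simp only: swap_vars_one divided_diff_one poly_op_one poly_op_0 add_0_right)
  next
    case (var m i)
    let ?j = "transpose k (Suc k) i"
    show ?case
    proof (cases "i \<in> {1..n}")
      case True
      then have j: "?j \<in> {1..n}" using k by (rule transpose_simple_mem)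
      have "poly_op n A (var i * frag_of m) (R k x) =
          poly_op n A (frag_of m) (R k (A ?j x)) + frag_cmul (simple_root k i) (poly_op n A (frag_of m) x)"
        using True var.prems k
        by (simp only: poly_op_var R_supported cross poly_op_linear_right)
      also have "\<dots> = R k (poly_op n A (swap_vars k (var i * frag_of m)) x) +
          poly_op n A (divided_diff k (var i * frag_of m)) x"
        using j var
        by (simp only: var.IH A_supported swap_vars_var_mult divided_diff_var_mult poly_op_var
          poly_op_add poly_op_cmul add.assoc)
      finally show ?thesis by (simp only: var_mult_frag_of)
    next
      case False
      \<comment> \<open>Such an \<open>x_i\<close> acts as the identity and is fixed by
        \<open>s_k\<close>, because \<open>Suc k\<close> is at most \<open>n\<close>.\<close>
      then have "?j = i" "simple_root k i = 0"
        using k by (auto simp: transpose_def simple_root_def)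
      then have "poly_op n A (var i * frag_of m) (R k x) =
          R k (poly_op n A (swap_vars k (var i * frag_of m)) x) +
          poly_op n A (divided_diff k (var i * frag_of m)) x"
        using False var
        by (simp only: poly_op_var_outside swap_vars_var_mult divided_diff_var_mult poly_op_add
          frag_cmul_zero poly_op_0 add_0_right not_False_eq_True)
      then show ?thesis by (simp only: var_mult_frag_of)
    qed
  qed
qed (simp_all add: R_linear R_diff poly_op_diff swap_vars_diff divided_diff_diff)

end

section \<open>Dunkl and Chevalley operators\<close>

text \<open>Coefficient of \<open>w t_ij\<close> in \<open>w * [ij]\<close>: the length condition
  becomes a comparison of two values, and the case \<open>j < i\<close> builds in
  \<open>[ji] = -[ij]\<close>.\<close>

definition swap_sign :: "(nat \<Rightarrow> nat) \<Rightarrow> nat \<Rightarrow> nat \<Rightarrow> int" where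
  "swap_sign w i j =
     (if i < j \<and> w j < w i then 1 else if j < i \<and> w i < w j then - 1 else 0)"

definition bracket :: "nat \<Rightarrow> nat \<Rightarrow> homology \<Rightarrow> homology" where
  "bracket i j = frag_extend (\<lambda>w. frag_cmul (swap_sign w i j) (frag_of (w \<circ> transpose i j)))"

definition dunkl_act :: "nat \<Rightarrow> nat \<Rightarrow> homology \<Rightarrow> homology" where
  "dunkl_act n i x = (\<Sum>j\<in>{1..n} - {i}. bracket i j x)"

definition right_swap :: "nat \<Rightarrow> homology \<Rightarrow> homology" where
  "right_swap k = frag_extend (\<lambda>w. frag_of (w \<circ> transpose k (Suc k)))"

definition cover_bracket :: "nat \<Rightarrow> nat \<Rightarrow> nat \<Rightarrow> homology \<Rightarrow> homology" where
  "cover_bracket n i j = frag_extend (\<lambda>w. if perm_length n (w \<circ> transpose i j) + 1 = perm_length n w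
     then frag_cmul (swap_sign w i j) (frag_of (w \<circ> transpose i j)) else 0)"

definition chevalley :: "nat \<Rightarrow> nat \<Rightarrow> homology \<Rightarrow> homology" where
  "chevalley n i x = (\<Sum>j\<in>{1..n} - {i}. cover_bracket n i j x)"

definition length_part :: "nat \<Rightarrow> nat \<Rightarrow> homology \<Rightarrow> homology" where
  "length_part n d = frag_extend (\<lambda>w. if perm_length n w = d then frag_of w else 0)"

lemma bracket_diff: "bracket i j (x - y) = bracket i j x - bracket i j y"
  and cover_bracket_diff: "cover_bracket n i j (x - y) = cover_bracket n i j x - cover_bracket n i j y"
  and right_swap_diff: "right_swap k (x - y) = right_swap k x - right_swap k y"
  and bgg_diff: "bgg n k (x - y) = bgg n k x - bgg n k y"
  and length_part_diff: "length_part n d (x - y) = length_part n d x - length_part n d y"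
  by (simp_all add: bracket_def cover_bracket_def right_swap_def bgg_def length_part_def
      frag_extend_diff)

lemma dunkl_act_diff: "dunkl_act n i (x - y) = dunkl_act n i x - dunkl_act n i y"
  by (simp add: dunkl_act_def bracket_diff sum_subtractf)

lemma chevalley_diff: "chevalley n i (x - y) = chevalley n i x - chevalley n i y"
  by (simp add: chevalley_def cover_bracket_diff sum_subtractf)

lemmas right_swap_linear = diff_imp_linear [of "right_swap k" for k, OF right_swap_diff]
lemmas bgg_linear = diff_imp_linear [of "bgg n k" for n k, OF bgg_diff]
lemmas length_part_linear = diff_imp_linear [of "length_part n d" for n d, OF length_part_diff]

section \<open>Cross relations for Dunkl operators and their length-preserving part\<close>

lemma swap_sign_nonzero:
  assumes "w permutes {1..n}" "i \<in> {1..n}" "j \<in> {1..n}" "swap_sign w i j \<noteq> 0"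
  shows "perm_length n (w \<circ> transpose i j) < perm_length n w"
proof -
  have "inj w" using assms(1) by (rule permutes_inj)
  then show ?thesis
    using assms perm_length_transpose_less [of i j n w] perm_length_transpose_less [of j i n w]
    by (auto simp: swap_sign_def transpose_commute split: if_splits)
qed

lemma transpose_conjugate:
  "transpose a b \<circ> transpose i j = transpose (transpose a b i) (transpose a b j) \<circ> transpose a b"
  by (simp add: transpose_comp_eq [of "transpose a b" "transpose a b i" "transpose a b j"])

text \<open>Conjugation by \<open>s_k\<close> reverses the order of the positions \<open>k\<close>
  and \<open>Suc k\<close> only, so the signs agree unless these are \<open>i\<close> and
  \<open>j\<close>. Then exactly one of \<open>w\<close> and \<open>w s_k\<close> has a descent at
  \<open>k\<close>, and the two sides differ by \<open>w\<close> with sign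
  \<open>simple_root k i\<close>.\<close>

lemma bracket_right_swap:
  assumes w: "w permutes {1..n}" and ij: "i \<noteq> j"
  shows "bracket i j (right_swap k (frag_of w)) =
    right_swap k (bracket (transpose k (Suc k) i) (transpose k (Suc k) j) (frag_of w)) +
    (if j = transpose k (Suc k) i then frag_cmul (simple_root k i) (frag_of w) else 0)"
proof -
  let ?s = "transpose k (Suc k)"
  have w_neq: "w k \<noteq> w (Suc k)"
    by (simp add: inj_eq [OF permutes_inj [OF w]])
  show ?thesis
  proof (cases "j = ?s i")
    case True
    then have "i = k \<and> j = Suc k \<or> i = Suc k \<and> j = k"
      using ij by (auto simp: transpose_def split: if_splits)
    moreover have "w \<circ> ?s \<circ> ?s = w" by (simp add: comp_assoc)
    moreover have "transpose (Suc k) k = ?s" by (rule transpose_commute)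
    ultimately show ?thesis
      using w_neq
      by (elim disjE; cases "w k < w (Suc k)")
        (simp_all add: bracket_def right_swap_def frag_extend_cmul frag_extend_minus simple_root_def
          swap_sign_def)
  next
    case False
    then have "?s i < ?s j \<longleftrightarrow> i < j" "?s j < ?s i \<longleftrightarrow> j < i"
      using ij by (auto simp: transpose_def split: if_splits)
    then have "swap_sign (w \<circ> ?s) i j = swap_sign w (?s i) (?s j)"
      by (simp add: swap_sign_def)
    with False show ?thesis
      by (simp add: bracket_def right_swap_def frag_extend_cmul comp_assoc
        transpose_conjugate [of k "Suc k" i j])
  qed
qed

lemma dunkl_act_cross:
  assumes w: "w permutes {1..n}" and i: "i \<in> {1..n}" and k: "k \<in> {1..<n}"
  shows "dunkl_act n i (right_swap k (frag_of w)) =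
    right_swap k (dunkl_act n (transpose k (Suc k) i) (frag_of w)) +
    frag_cmul (simple_root k i) (frag_of w)"
proof -
  let ?s = "transpose k (Suc k)"
  \<comment> \<open>\<open>s_k\<close> carries the partners of \<open>i\<close> to the partners of
    its image.\<close>
  have "bij_betw ?s ({1..n} - {i}) ({1..n} - {?s i})"
    using k by (simp add: bij_betw_def image_set_diff [OF inj_transpose] transpose_image_eq)
  then have "(\<Sum>j\<in>{1..n} - {i}. right_swap k (bracket (?s i) (?s j) (frag_of w))) =
      right_swap k (dunkl_act n (?s i) (frag_of w))"
    unfolding dunkl_act_def right_swap_linear(4) by (rule sum.reindex_bij_betw)
  \<comment> \<open>If \<open>s_k\<close> fixes \<open>i\<close>, the exceptional index is absent
    from the sum, and \<open>simple_root k i\<close> vanishes as well.\<close>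
  moreover have "(\<Sum>j\<in>{1..n} - {i}. if j = ?s i then frag_cmul (simple_root k i) (frag_of w) else 0) =
      frag_cmul (simple_root k i) (frag_of w)"
  proof (cases "?s i = i")
    case True
    then have "simple_root k i = 0" by (auto simp: simple_root_def transpose_eq_iff)
    then show ?thesis by simp
  next
    case False
    then show ?thesis using transpose_simple_mem [OF i k] by simp
  qed
  moreover have "dunkl_act n i (right_swap k (frag_of w)) =
      (\<Sum>j\<in>{1..n} - {i}. right_swap k (bracket (?s i) (?s j) (frag_of w)) +
        (if j = ?s i then frag_cmul (simple_root k i) (frag_of w) else 0))"
    unfolding dunkl_act_def by (intro sum.cong refl bracket_right_swap [OF w]) auto
  ultimately show ?thesis by (simp only: sum.distrib)
qed

lemma permutes_simple_swap: "w permutes {1..n} \<Longrightarrow> k \<in> {1..<n} \<Longrightarrow> w \<circ> transpose k (Suc k) permutes {1..n}"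
  by (rule permutes_comp_transpose) auto

text \<open>\<open>bracket\<close> lowers the length and \<open>s_k\<close> changes it by one. A
  total change of zero forces \<open>s_k\<close> to raise it and \<open>bracket\<close> to lower it
  by exactly one.\<close>

lemma cover_bracket_bgg:
  assumes w: "w permutes {1..n}" and ij: "i \<in> {1..n}" "j \<in> {1..n}" and k: "k \<in> {1..<n}"
  shows "cover_bracket n i j (bgg n k (frag_of w)) =
    length_part n (perm_length n w) (bracket i j (right_swap k (frag_of w)))"
proof -
  define u v where "u = w \<circ> transpose k (Suc k)" and "v = u \<circ> transpose i j"
  have "cover_bracket n i j (bgg n k (frag_of w)) =
      (if perm_length n w < perm_length n u \<and> perm_length n v + 1 = perm_length n u
       then frag_cmul (swap_sign u i j) (frag_of v) else 0)"
    by (simp add: cover_bracket_def bgg_def flip: u_def v_def)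
  moreover have "length_part n (perm_length n w) (bracket i j (right_swap k (frag_of w))) =
      (if perm_length n v = perm_length n w then frag_cmul (swap_sign u i j) (frag_of v) else 0)"
    by (simp add: length_part_def bracket_def right_swap_def frag_extend_cmul flip: u_def v_def)
  moreover have "perm_length n w < perm_length n u \<and> perm_length n v + 1 = perm_length n u \<longleftrightarrow>
      perm_length n v = perm_length n w" if "swap_sign u i j \<noteq> 0"
  proof -
    have "perm_length n v < perm_length n u"
      using swap_sign_nonzero [OF permutes_simple_swap [OF w k] ij] that by (simp add: u_def v_def)
    moreover have "perm_length n u + 1 = perm_length n w \<or> perm_length n u = perm_length n w + 1"
      unfolding u_def by (rule perm_length_simple_cases [OF k permutes_inj [OF w]]) simp_all
    ultimately show ?thesis by linarith
  qed
  ultimately show ?thesis by (cases "swap_sign u i j = 0") simp_all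
qed

text \<open>The same count with the drop first: only a drop by one can be made up by
  \<open>s_k\<close>.\<close>

lemma bgg_cover_bracket:
  assumes w: "w permutes {1..n}" and ij: "i \<in> {1..n}" "j \<in> {1..n}" and k: "k \<in> {1..<n}"
  shows "bgg n k (cover_bracket n i j (frag_of w)) =
    length_part n (perm_length n w) (right_swap k (bracket i j (frag_of w)))"
proof -
  define u v where "u = w \<circ> transpose i j" and "v = u \<circ> transpose k (Suc k)"
  have "bgg n k (cover_bracket n i j (frag_of w)) =
      (if perm_length n u < perm_length n v \<and> perm_length n u + 1 = perm_length n w
       then frag_cmul (swap_sign w i j) (frag_of v) else 0)"
    by (simp add: cover_bracket_def bgg_def frag_extend_cmul flip: u_def v_def)
  moreover have "length_part n (perm_length n w) (right_swap k (bracket i j (frag_of w))) =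
      (if perm_length n v = perm_length n w then frag_cmul (swap_sign w i j) (frag_of v) else 0)"
    by (simp add: length_part_def bracket_def right_swap_def frag_extend_cmul flip: u_def v_def)
  moreover have "perm_length n u < perm_length n v \<and> perm_length n u + 1 = perm_length n w \<longleftrightarrow>
      perm_length n v = perm_length n w" if "swap_sign w i j \<noteq> 0"
  proof -
    have "perm_length n u < perm_length n w"
      using swap_sign_nonzero [OF w ij that] by (simp add: u_def)
    moreover have "perm_length n v + 1 = perm_length n u \<or> perm_length n v = perm_length n u + 1"
      unfolding v_def u_def
      by (rule perm_length_simple_cases [OF k permutes_inj [OF permutes_comp_transpose [OF w ij]]])
        simp_all
    ultimately show ?thesis by linarith
  qed
  ultimately show ?thesis by (cases "swap_sign w i j = 0") simp_all
qed

text \<open>The cross relation for \<open>chevalley\<close> and \<open>bgg\<close> is the length-preserving part of that for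
  \<open>dunkl_act\<close> and \<open>right_swap\<close>.\<close>

lemma chevalley_cross:
  assumes w: "w permutes {1..n}" and i: "i \<in> {1..n}" and k: "k \<in> {1..<n}"
  shows "chevalley n i (bgg n k (frag_of w)) =
    bgg n k (chevalley n (transpose k (Suc k) i) (frag_of w)) +
    frag_cmul (simple_root k i) (frag_of w)"
proof -
  let ?L = "length_part n (perm_length n w)"
  have "chevalley n i (bgg n k (frag_of w)) = ?L (dunkl_act n i (right_swap k (frag_of w)))"
    unfolding chevalley_def dunkl_act_def length_part_linear
    using assms by (intro sum.cong refl cover_bracket_bgg) auto
  moreover have "bgg n k (chevalley n (transpose k (Suc k) i) (frag_of w)) =
      ?L (right_swap k (dunkl_act n (transpose k (Suc k) i) (frag_of w)))"
    unfolding chevalley_def dunkl_act_def length_part_linear right_swap_linear bgg_linear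
    using assms transpose_simple_mem [OF i k] by (intro sum.cong refl bgg_cover_bracket) auto
  moreover have "?L (frag_of w) = frag_of w"
    by (simp add: length_part_def)
  ultimately show ?thesis
    by (simp only: dunkl_act_cross [OF assms] length_part_linear)
qed

lemma permutes_descent_exists:
  assumes "w permutes {1..n}" "w \<noteq> id"
  obtains k where "k \<in> {1..<n}" "w (Suc k) < w k"
    "perm_length n (w \<circ> transpose k (Suc k)) < perm_length n w"
proof -
  obtain k where k: "k \<in> {1..<n}" "\<not> w k < w (Suc k)"
    using permutes_no_descent [OF assms(1)] assms(2) by blast
  have "w (Suc k) < w k \<and> perm_length n (w \<circ> transpose k (Suc k)) < perm_length n w"
    by (rule perm_length_simple_cases [OF k(1) permutes_inj [OF assms(1)]]) (use k(2) in auto)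
  then have "w (Suc k) < w k" "perm_length n (w \<circ> transpose k (Suc k)) < perm_length n w"
    by simp_all
  with k(1) show ?thesis by (rule that)
qed

lemma bracket_supported:
  "w permutes {1..n} \<Longrightarrow> i \<in> {1..n} \<Longrightarrow> j \<in> {1..n} \<Longrightarrow> supported n (bracket i j (frag_of w))"
  by (simp add: bracket_def supported_cmul permutes_comp_transpose)

lemma cover_bracket_supported:
  "w permutes {1..n} \<Longrightarrow> i \<in> {1..n} \<Longrightarrow> j \<in> {1..n} \<Longrightarrow> supported n (cover_bracket n i j (frag_of w))"
  by (simp add: cover_bracket_def supported_cmul permutes_comp_transpose)

lemma swap_sign_id [simp]: "swap_sign id i j = 0"
  by (simp add: swap_sign_def)

lemma dunkl_act_id: "dunkl_act n i (frag_of id) = 0"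
  by (simp add: dunkl_act_def bracket_def)

lemma chevalley_id: "chevalley n i (frag_of id) = 0"
  unfolding chevalley_def cover_bracket_def frag_extend_of by (intro sum.neutral) simp

interpretation dunkl: hecke_action n "dunkl_act n" right_swap for n
proof
  fix w and k :: nat
  assume w: "w permutes {1..n}"
  show "supported n (dunkl_act n i (frag_of w))" if "i \<in> {1..n}" for i
    unfolding dunkl_act_def using that w by (intro supported_sum bracket_supported) auto
  show "supported n (right_swap k (frag_of w))" if "k \<in> {1..<n}"
    using w that by (simp add: right_swap_def permutes_simple_swap del: atLeastLessThan_iff)
  show "\<exists>k\<in>{1..<n}. \<exists>u. u permutes {1..n} \<and> perm_length n u < perm_length n w \<and>
      frag_of w = right_swap k (frag_of u)" if non_id: "w \<noteq> id"
  proof -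
    obtain k where "k \<in> {1..<n}" "perm_length n (w \<circ> transpose k (Suc k)) < perm_length n w"
      by (rule permutes_descent_exists [OF w non_id])
    then show ?thesis
      using permutes_simple_swap [OF w]
      by (intro bexI [of _ k] exI [of _ "w \<circ> transpose k (Suc k)"])
        (auto simp: right_swap_def comp_assoc)
  qed
qed (rule dunkl_act_diff | rule right_swap_diff | rule dunkl_act_id | erule (2) dunkl_act_cross)+

interpretation chevalley: hecke_action n "chevalley n" "bgg n" for n
proof
  fix w and k :: nat
  assume w: "w permutes {1..n}"
  show "supported n (chevalley n i (frag_of w))" if "i \<in> {1..n}" for i
    unfolding chevalley_def using that w by (intro supported_sum cover_bracket_supported) auto
  show "supported n (bgg n k (frag_of w))" if "k \<in> {1..<n}"
    using w that by (simp add: bgg_def Let_def permutes_simple_swap del: atLeastLessThan_iff)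
  show "\<exists>k\<in>{1..<n}. \<exists>u. u permutes {1..n} \<and> perm_length n u < perm_length n w \<and>
      frag_of w = bgg n k (frag_of u)" if non_id: "w \<noteq> id"
  proof -
    \<comment> \<open>A descent of \<open>w\<close> is an ascent of \<open>w s_k\<close>, so
      \<open>bgg\<close> sends the latter to \<open>w\<close>.\<close>
    obtain k where "k \<in> {1..<n}" "perm_length n (w \<circ> transpose k (Suc k)) < perm_length n w"
      by (rule permutes_descent_exists [OF w non_id])
    then show ?thesis
      using permutes_simple_swap [OF w]
      by (intro bexI [of _ k] exI [of _ "w \<circ> transpose k (Suc k)"])
        (auto simp: bgg_def comp_assoc)
  qed
qed (rule chevalley_diff | rule bgg_diff | rule chevalley_id | erule (2) chevalley_cross)+

section \<open>The duality pairing and CSM classes\<close>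

text \<open>\<open>chevalley n i\<close> is the cap product with the first Chern class for the
  weight \<epsilon>_i, so this is the degree of a polynomial in such classes capped with
  \<open>x\<close>.\<close>

definition pair :: "nat \<Rightarrow> ipoly \<Rightarrow> homology \<Rightarrow> int" where
  "pair n f x = Poly_Mapping.lookup (poly_op n (chevalley n) f x) id"

lemma pair_diff_right: "pair n f (x - y) = pair n f x - pair n f y"
  by (simp add: pair_def chevalley.poly_op_diff_right lookup_minus)

lemma pair_0_right [simp]: "pair n f 0 = 0"
  by (simp add: pair_def chevalley.poly_op_linear_right)

lemma pair_0_left [simp]: "pair n 0 x = 0"
  and pair_diff_left: "pair n (f - g) x = pair n f x - pair n g x"
  by (simp_all add: pair_def poly_op_diff lookup_minus)

lemma lookup_bgg_id:
  assumes "u = id"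
  shows "Poly_Mapping.lookup (bgg n k x) u = 0"
proof (induction x rule: frag_induction [OF subset_UNIV])
  case (2 w)
  have "w \<circ> transpose k (Suc k) \<noteq> u"
    if "perm_length n w < perm_length n (w \<circ> transpose k (Suc k))"
    using that assms by (auto simp: perm_length_id)
  then show ?case by (auto simp: bgg_def Let_def lookup_single)
qed (simp_all add: bgg_linear bgg_diff lookup_minus)

text \<open>In \<open>poly_op_cross\<close> the term in the image of \<open>bgg\<close> has no
  coefficient at the identity, so only the divided difference survives.\<close>

lemma pair_bgg:
  assumes "supported n x" "k \<in> {1..<n}"
  shows "pair n f (bgg n k x) = pair n (divided_diff k f) x"
  using assms by (simp add: pair_def chevalley.poly_op_cross lookup_add lookup_bgg_id)

section \<open>The Chevalley formula and the adjoint of \<open>dl_op\<close>\<close>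

lemma chern_cap_diff: "chern_cap n \<mu> (x - y) = chern_cap n \<mu> x - chern_cap n \<mu> y"
  by (simp add: chern_cap_def frag_extend_diff)

text \<open>Each cover occurs twice among the ordered pairs: as \<open>(a, b)\<close> with weight
  \<open>\<mu> a\<close> and sign plus, as \<open>(b, a)\<close> with weight \<open>\<mu> b\<close>
  and sign minus.\<close>

lemma chern_cap_perm:
  assumes w: "w permutes {1..n}"
  shows "chern_cap n \<mu> (frag_of w) = (\<Sum>i\<in>{1..n}. frag_cmul (\<mu> i) (chevalley n i (frag_of w)))"
proof -
  define C where "C = {(a, b). 1 \<le> a \<and> a < b \<and> b \<le> n \<and>
    perm_length n (w \<circ> transpose a b) + 1 = perm_length n w}"
  define f where "f = (\<lambda>(i, j). frag_cmul (\<mu> i) (cover_bracket n i j (frag_of w)))"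
  have C_sub: "C \<subseteq> {1..n} \<times> {1..n}" by (auto simp: C_def)
  have fin: "finite C" by (rule finite_subset [OF C_sub]) simp
  have "(\<Sum>i\<in>{1..n}. frag_cmul (\<mu> i) (chevalley n i (frag_of w))) =
      (\<Sum>p\<in>(SIGMA i:{1..n}. {1..n} - {i}). f p)"
    by (simp add: chevalley_def frag_cmul_sum sum.Sigma f_def)
  also have "\<dots> = (\<Sum>p\<in>C \<union> prod.swap ` C. f p)"
  proof (rule sum.mono_neutral_right)
    show "\<forall>p\<in>(SIGMA i:{1..n}. {1..n} - {i}) - (C \<union> prod.swap ` C). f p = 0"
    proof
      fix p assume p: "p \<in> (SIGMA i:{1..n}. {1..n} - {i}) - (C \<union> prod.swap ` C)"
      obtain i j where ij: "p = (i, j)" by (cases p)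
      have "perm_length n (w \<circ> transpose i j) + 1 \<noteq> perm_length n w"
      proof (cases "i < j")
        case True
        with p ij show ?thesis by (auto simp: C_def)
      next
        case False
        with p ij have "(j, i) \<notin> C" "j < i" "1 \<le> j" "i \<le> n" by force+
        then show ?thesis by (simp add: C_def transpose_commute)
      qed
      then show "f p = 0" by (simp add: f_def ij cover_bracket_def)
    qed
  qed (use C_sub in \<open>auto simp: C_def\<close>)
  also have "\<dots> = (\<Sum>p\<in>C. f p) + (\<Sum>p\<in>C. f (prod.swap p))"
    using fin by (subst sum.union_disjoint) (auto simp: C_def sum.reindex)
  also have "\<dots> = (\<Sum>(a, b)\<in>C. frag_cmul (\<mu> a - \<mu> b) (frag_of (w \<circ> transpose a b)))"
    unfolding sum.distrib [symmetric]
  proof (intro sum.cong refl, clarify)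
    fix a b assume ab: "(a, b) \<in> C"
    then have "w b < w a"
      using perm_length_transpose_less_iff [of a b n w] permutes_inj [OF w] by (simp add: C_def)
    moreover have "transpose b a = transpose a b" by (rule transpose_commute)
    ultimately show "f (a, b) + f (prod.swap (a, b)) =
        frag_cmul (\<mu> a - \<mu> b) (frag_of (w \<circ> transpose a b))"
      using ab by (simp add: C_def f_def cover_bracket_def swap_sign_def frag_cmul_diff_distrib
        flip: frag_cmul_minus_one)
  qed
  also have "\<dots> = chern_cap n \<mu> (frag_of w)"
    by (simp add: chern_cap_def C_def)
  finally show ?thesis by (rule sym)
qed

lemma chern_cap_simple_root:
  assumes "supported n x" "k \<in> {1..<n}"
  shows "chern_cap n (simple_root k) x = chevalley n k x - chevalley n (Suc k) x"
  using assms(1)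
proof (induction rule: supported_induct)
  case (perm w)
  let ?c = "\<lambda>i. chevalley n i (frag_of w)"
  have "frag_cmul (simple_root k i) (?c i) = (if i = k then ?c i else 0) - (if i = Suc k then ?c i else 0)" for i
    by (simp add: simple_root_def)
  then have "(\<Sum>i\<in>{1..n}. frag_cmul (simple_root k i) (?c i)) = ?c k - ?c (Suc k)"
    using assms(2) by (simp add: sum_subtractf)
  then show ?case by (simp add: chern_cap_perm [OF perm])
qed (simp_all add: chern_cap_diff chevalley_diff chevalley.A_linear
    diff_imp_linear(1) [of "chern_cap n \<mu>" for \<mu>])

text \<open>\<open>T_k\<close> is \<open>\<partial>_k - id\<close> plus the Chern class of
  \<alpha>_k capped with \<open>\<partial>_k\<close>. Its adjoint sends \<open>f\<close> to
  \<open>\<partial>_k f - f + \<partial>_k ((x_k - x_(k+1)) f)\<close>, and the last term is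
  \<open>f + s_k f\<close>.\<close>

lemma pair_dl_op:
  assumes x: "supported n x" and k: "k \<in> {1..<n}"
  shows "pair n f (dl_op n k x) = pair n (swap_vars k f + divided_diff k f) x"
proof -
  let ?y = "bgg n k x"
  have y: "supported n ?y" using x k by (rule chevalley.R_supported)
  have var: "pair n f (chevalley n i ?y) = pair n (divided_diff k (var i * f)) x" if "i \<in> {1..n}" for i
    using pair_bgg [OF x k, of "var i * f"] that y by (simp add: pair_def chevalley.poly_op_var)
  have dl: "dl_op n k x = ?y - (x - (chevalley n k ?y - chevalley n (Suc k) ?y))"
    by (simp only: dl_op_def refl_op_def chern_cap_simple_root [OF y k])
  have "pair n f (dl_op n k x) = pair n (divided_diff k f - (f -
      (divided_diff k (var k * f) - divided_diff k (var (Suc k) * f)))) x"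
    using k by (simp add: dl pair_diff_right pair_diff_left pair_bgg x var)
  moreover have "divided_diff k f - (f -
      (divided_diff k (var k * f) - divided_diff k (var (Suc k) * f))) =
      divided_diff k f + f - divided_diff k f * (var k - var (Suc k))"
    unfolding divided_diff_var_mult by (simp add: simple_root_def algebra_simps)
  ultimately show ?thesis
    unfolding divided_diff_mult by (simp only:) (simp add: add.commute)
qed

section \<open>The functional of the Bruhat action and its agreement with CSM classes\<close>

definition dunkl_functional :: "nat \<Rightarrow> ipoly \<Rightarrow> homology \<Rightarrow> int" where
  "dunkl_functional n f x = psi (poly_op n (dunkl_act n) f x)"

lemma psi_diff: "psi (x - y) = psi x - psi y"
  using psi_add [of "x - y" y] by simp

lemma psi_right_swap: "psi (right_swap k x) = psi x"
  by (induction x rule: frag_induction [OF subset_UNIV])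
    (simp_all add: right_swap_diff right_swap_linear psi_diff, simp add: right_swap_def)

text \<open>\<open>psi\<close> does not see right multiplication, so the cross relation loses its
  outer \<open>right_swap\<close>.\<close>

lemma dunkl_functional_right_swap:
  assumes "supported n x" "k \<in> {1..<n}"
  shows "dunkl_functional n f (right_swap k x) =
    dunkl_functional n (swap_vars k f + divided_diff k f) x"
  using assms
  by (simp add: dunkl_functional_def dunkl.poly_op_cross psi_add psi_right_swap poly_op_add)

lemma monom_op_annihilated:
  assumes diff: "\<And>i x y. A i (x - y) = A i x - A i y" and zero: "\<And>i. A i e = 0"
  shows "monom_op n A m e = (if \<forall>i\<in>{1..n}. Poly_Mapping.lookup m i = 0 then e else 0)"
proof -
  have zero_0: "(A i ^^ p) 0 = 0" for i p
    using diff_imp_linear(1) [of "A i", OF diff] by (induction p) auto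
  have pow: "(A i ^^ p) e = (if p = 0 then e else 0)" for i p
    using diff_imp_linear(1) [of "A i", OF diff] by (induction p) (auto simp: zero)
  have zeros: "foldl (\<lambda>y i. (A i ^^ Poly_Mapping.lookup m i) y) 0 js = 0" for js
    by (induction js) (auto simp: zero_0)
  have "foldl (\<lambda>y i. (A i ^^ Poly_Mapping.lookup m i) y) e js =
      (if \<forall>i\<in>set js. Poly_Mapping.lookup m i = 0 then e else 0)" for js
    by (induction js) (auto simp: pow zeros)
  moreover have "set [1..<Suc n] = {1..n}" by auto
  ultimately show ?thesis by (simp add: monom_op_def del: upt_Suc)
qed

text \<open>Both families of operators kill the identity, so either side is the sum of the
  coefficients of the monomials free of \<open>x_1, ..., x_n\<close>.\<close>

lemma dunkl_functional_id: "dunkl_functional n f (frag_of id) = pair n f (frag_of id)"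
proof -
  define e :: homology and u :: "nat \<Rightarrow> nat" where "e = frag_of id" and "u = id"
  have "psi (poly_op n (dunkl_act n) f e) = Poly_Mapping.lookup (poly_op n (chevalley n) f e) u"
  proof (induction f rule: frag_induction [OF subset_UNIV])
    case (2 m)
    have "monom_op n (dunkl_act n) m e = (if \<forall>i\<in>{1..n}. Poly_Mapping.lookup m i = 0 then e else 0)"
      unfolding e_def by (rule monom_op_annihilated) (simp_all only: dunkl_act_diff dunkl_act_id)
    moreover have "monom_op n (chevalley n) m e =
        (if \<forall>i\<in>{1..n}. Poly_Mapping.lookup m i = 0 then e else 0)"
      unfolding e_def by (rule monom_op_annihilated) (simp_all only: chevalley_diff chevalley_id)
    moreover have "psi e = 1" "Poly_Mapping.lookup e u = 1"
      by (simp_all add: e_def u_def)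
    ultimately show ?case by (simp add: poly_op_frag_of)
  qed (simp_all add: poly_op_diff psi_diff lookup_minus)
  then show ?thesis by (simp add: dunkl_functional_def pair_def e_def u_def)
qed

lemma dl_op_supported:
  assumes "supported n x" "k \<in> {1..<n}"
  shows "supported n (dl_op n k x)"
  using assms
  by (auto simp: dl_op_def refl_op_def chern_cap_simple_root chevalley.R_supported
      intro!: supported_diff chevalley.A_supported)

text \<open>Induction along the recursion for CSM classes, for all \<open>f\<close> at once, since a
  step replaces \<open>f\<close> by \<open>s_k f + \<partial>_k f\<close> on both sides.\<close>

lemma is_csm_pair:
  assumes "is_csm n w x"
  shows "w permutes {1..n} \<and> supported n x \<and>
    (\<forall>f. dunkl_functional n f (frag_of w) = pair n f x)"
  using assms
proof induction
  case point
  have "id permutes {1..n} \<and> supported n (frag_of id) \<and>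
      (\<forall>f. dunkl_functional n f (frag_of id) = pair n f (frag_of id))"
    by (simp add: permutes_id dunkl_functional_id)
  then show ?case .
next
  case (step w x k)
  then have w: "w permutes {1..n}" and x: "supported n x"
    and eq: "dunkl_functional n f (frag_of w) = pair n f x" for f
    by blast+
  have "right_swap k (frag_of w) = frag_of (w \<circ> transpose k (Suc k))"
    by (simp add: right_swap_def)
  then have "dunkl_functional n f (frag_of (w \<circ> transpose k (Suc k))) = pair n f (dl_op n k x)" for f
    using dunkl_functional_right_swap [of n "frag_of w" k f] pair_dl_op [OF x, of k f] w step.hyps(2) eq
    by simp
  with w x step.hyps(2) show ?case
    using permutes_simple_swap dl_op_supported by blast
qed

lemma is_csm_exists: "w permutes {1..n} \<Longrightarrow> \<exists>x. is_csm n w x"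
proof (induction "perm_length n w" arbitrary: w rule: less_induct)
  case less
  show ?case
  proof (cases "w = id")
    case True
    then show ?thesis using is_csm.point by blast
  next
    case False
    obtain k where k: "k \<in> {1..<n}" "perm_length n (w \<circ> transpose k (Suc k)) < perm_length n w"
      by (rule permutes_descent_exists [OF less.prems False])
    then obtain x where "is_csm n (w \<circ> transpose k (Suc k)) x"
      using less permutes_simple_swap by blast
    from is_csm.step [OF this k(1)] show ?thesis by (auto simp: comp_assoc)
  qed
qed

section \<open>Schubert polynomials as a dual basis\<close>

lemma cover_bracket_frag_of:
  "cover_bracket n i j (frag_of w) = 0 \<or>
   swap_sign w i j \<noteq> 0 \<and> cover_bracket n i j (frag_of w) =
     frag_cmul (swap_sign w i j) (frag_of (w \<circ> transpose i j))"
  by (simp add: cover_bracket_def)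

text \<open>Positions before \<open>m\<close> are fixed and hold values less than
  \<open>w m\<close>, so only a later position can give a nonzero sign.\<close>

lemma swap_sign_lower:
  assumes w: "w permutes {m..n}" and m: "1 \<le> m" "m \<le> n" and j: "j \<in> {1..n}"
    and "swap_sign w m j \<noteq> 0"
  shows "m < j" "w j < w m" "w \<circ> transpose m j permutes {m..n}"
proof -
  have "w m \<in> {m..n}" using permutes_in_image [OF w, of m] m by simp
  moreover have "w j = j" if "j < m" using permutes_not_in [OF w] that by simp
  ultimately show *: "m < j" "w j < w m"
    using assms(5) by (auto simp: swap_sign_def split: if_splits)
  show "w \<circ> transpose m j permutes {m..n}"
    using w m j * by (intro permutes_compose permutes_swap_id) auto
qed

lemmas chevalley_pow_linear =
  diff_imp_linear [of "chevalley n i ^^ p" for n i p, OF chevalley.funpow_diff]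

lemma chevalley_pow_term_eq_0:
  assumes "swap_sign w m j \<noteq> 0 \<Longrightarrow> (chevalley n m ^^ p) (frag_of (w \<circ> transpose m j)) = 0"
  shows "(chevalley n m ^^ p) (cover_bracket n m j (frag_of w)) = 0"
  using cover_bracket_frag_of [of n m j w] assms
  by (auto simp: chevalley_pow_linear simp del: frag_cmul_eq_0_iff)

text \<open>Each factor strictly lowers the value at position \<open>m\<close>, which never falls
  below \<open>m\<close>.\<close>

lemma chevalley_pow_eq_0:
  assumes m: "1 \<le> m" "m \<le> n"
  shows "w permutes {m..n} \<Longrightarrow> w m < m + p \<Longrightarrow> (chevalley n m ^^ p) (frag_of w) = 0"
proof (induction p arbitrary: w)
  case 0
  then show ?case using permutes_in_image [OF 0(1), of m] m by simp
next
  case (Suc p)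
  have "(chevalley n m ^^ p) (cover_bracket n m j (frag_of w)) = 0" if j: "j \<in> {1..n}" for j
  proof (rule chevalley_pow_term_eq_0)
    assume "swap_sign w m j \<noteq> 0"
    note lower = swap_sign_lower [OF Suc.prems(1) m j this]
    with Suc.prems(2) have "(w \<circ> transpose m j) m < m + p" by simp
    with lower(3) show "(chevalley n m ^^ p) (frag_of (w \<circ> transpose m j)) = 0"
      by (rule Suc.IH)
  qed
  then show ?case
    by (simp add: funpow_swap1 chevalley_def [of n m "frag_of w"] chevalley_pow_linear
        del: funpow.simps add: funpow_Suc_right)
qed

text \<open>The value at \<open>m\<close> is raised by one at the cost of one factor \<open>chevalley n m\<close>; the further
  terms of the Chevalley formula are killed by the remaining factors.\<close>

lemma chevalley_pow_raise:
  assumes m: "1 \<le> m" "m \<le> n" and w: "w permutes {m..n}" "w m = m + p" "m + p < n"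
  shows "\<exists>u. u permutes {m..n} \<and> u m = m + Suc p \<and>
    (chevalley n m ^^ Suc p) (frag_of u) = (chevalley n m ^^ p) (frag_of w)"
proof -
  \<comment> \<open>\<open>b\<close> holds the next value \<open>m + Suc p\<close>. Exchanging it
    with the value at \<open>m\<close> gives \<open>u\<close>; as no value lies between the two,
    \<open>u\<close> covers \<open>w\<close>.\<close>
  obtain b where wb: "w b = m + Suc p"
    using permutes_surj [OF w(1)] by (metis surjD)
  then have b: "b \<in> {m..n}" "b \<noteq> m"
    using permutes_in_image [OF w(1), of b] w m by auto
  define u where "u = w \<circ> transpose m b"
  have u: "u permutes {m..n}" "u m = m + Suc p" "u b = m + p"
    using w b m wb by (auto simp: u_def intro!: permutes_compose permutes_swap_id)
  have inj: "inj u" using u(1) by (rule permutes_inj)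
  have ub: "u \<circ> transpose m b = w" by (simp add: u_def comp_assoc)
  have "perm_length n (u \<circ> transpose m b) + 1 = perm_length n u"
    using b m u inj by (intro perm_length_transpose_cover) auto
  then have main: "cover_bracket n m b (frag_of u) = frag_of w"
    using b u ub by (simp add: cover_bracket_def swap_sign_def)
  \<comment> \<open>Any other term puts at \<open>m\<close> a value below \<open>m + Suc p\<close>
    and different from \<open>u b = m + p\<close>, too small to survive \<open>p\<close> more
    factors.\<close>
  have "(chevalley n m ^^ p) (cover_bracket n m j (frag_of u)) = 0"
    if j: "j \<in> {1..n}" "j \<noteq> b" for j
  proof (rule chevalley_pow_term_eq_0)
    assume "swap_sign u m j \<noteq> 0"
    note lower = swap_sign_lower [OF u(1) m j(1) this]
    moreover have "u j \<noteq> u b" using j(2) inj by (simp add: inj_eq)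
    ultimately have "(u \<circ> transpose m j) m < m + p" using u by simp
    with m lower(3) show "(chevalley n m ^^ p) (frag_of (u \<circ> transpose m j)) = 0"
      by (rule chevalley_pow_eq_0)
  qed
  then have "(\<Sum>j\<in>{1..n} - {m}. (chevalley n m ^^ p) (cover_bracket n m j (frag_of u))) =
      (\<Sum>j\<in>{1..n} - {m}. if j = b then (chevalley n m ^^ p) (frag_of w) else 0)"
    by (intro sum.cong) (auto simp: main)
  also have "\<dots> = (chevalley n m ^^ p) (frag_of w)"
    using b m by simp
  finally have "(chevalley n m ^^ Suc p) (frag_of u) = (chevalley n m ^^ p) (frag_of w)"
    by (simp add: chevalley_def [of n m "frag_of u"] chevalley_pow_linear funpow_Suc_right
        del: funpow.simps)
  with u show ?thesis by blast
qed

lemma chevalley_pow_exists: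
  assumes m: "1 \<le> m" "m \<le> n" and w: "w permutes {Suc m..n}" and p: "m + p \<le> n"
  shows "\<exists>u. u permutes {m..n} \<and> u m = m + p \<and> (chevalley n m ^^ p) (frag_of u) = frag_of w"
  using p
proof (induction p)
  case 0
  have "w permutes {m..n}" using w by (rule permutes_subset) auto
  moreover have "w m = m" using w by (simp add: permutes_not_in)
  ultimately show ?case by auto
next
  case (Suc p)
  then obtain u where u: "u permutes {m..n}" "u m = m + p"
    "(chevalley n m ^^ p) (frag_of u) = frag_of w" by auto
  with chevalley_pow_raise [OF m u(1,2)] Suc.prems show ?case by auto
qed

text \<open>Truncation of \<open>monom_op\<close>, set up for downward induction on
  \<open>m\<close>; \<open>m = 1\<close> gives the full operator.\<close>

definition tail_op :: "nat \<Rightarrow> nat \<Rightarrow> (nat \<Rightarrow>\<^sub>0 nat) \<Rightarrow> homology \<Rightarrow> homology" where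
  "tail_op n m b x = foldl (\<lambda>y i. (chevalley n i ^^ Poly_Mapping.lookup b i) y) x [m..<Suc n]"

lemma tail_op_Suc:
  "m \<le> n \<Longrightarrow> tail_op n m b x = tail_op n (Suc m) b ((chevalley n m ^^ Poly_Mapping.lookup b m) x)"
  by (simp add: tail_op_def upt_conv_Cons del: upt_Suc)

lemma tail_op_0: "tail_op n m b 0 = 0"
proof -
  have "foldl (\<lambda>y i. (chevalley n i ^^ Poly_Mapping.lookup b i) y) 0 js = 0" for js
    by (induction js) (auto simp: chevalley_pow_linear)
  then show ?thesis by (simp only: tail_op_def)
qed

text \<open>The witness \<open>w\<close> is the permutation with Lehmer code \<open>a\<close>.\<close>

lemma tail_op_triangular:
  assumes a: "a \<in> staircase n" and m: "1 \<le> m" "m \<le> Suc n"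
  shows "\<exists>w. w permutes {m..n} \<and> tail_op n m a (frag_of w) = frag_of id \<and>
    (\<forall>b i. m \<le> i \<longrightarrow> i \<le> n \<longrightarrow> Poly_Mapping.lookup a i < Poly_Mapping.lookup b i \<longrightarrow>
      (\<forall>j<i. Poly_Mapping.lookup b j = Poly_Mapping.lookup a j) \<longrightarrow> tail_op n m b (frag_of w) = 0)"
  using m(2,1)
proof (induction rule: inc_induct)
  case base
  show ?case by (intro exI [of _ id]) (simp add: tail_op_def flip: id_def)
next
  case (step m)
  obtain w where w: "w permutes {Suc m..n}" "tail_op n (Suc m) a (frag_of w) = frag_of id"
    and larger: "\<And>b i. Suc m \<le> i \<Longrightarrow> i \<le> n \<Longrightarrow> Poly_Mapping.lookup a i < Poly_Mapping.lookup b i \<Longrightarrow>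
      (\<forall>j<i. Poly_Mapping.lookup b j = Poly_Mapping.lookup a j) \<Longrightarrow>
      tail_op n (Suc m) b (frag_of w) = 0"
    using step.IH [OF le_SucI [OF step.prems]] by blast
  have m: "1 \<le> m" "m \<le> n" using step by auto
  have "Poly_Mapping.lookup a m \<le> (if m \<in> {1..n} then n - m else 0)"
    using a unfolding staircase_def by blast
  \<comment> \<open>The staircase bound leaves room for this value at position
    \<open>m\<close>.\<close>
  then have "m + Poly_Mapping.lookup a m \<le> n" using m by simp
  from chevalley_pow_exists [OF m w(1) this] obtain u where u: "u permutes {m..n}"
    "u m = m + Poly_Mapping.lookup a m" "(chevalley n m ^^ Poly_Mapping.lookup a m) (frag_of u) = frag_of w"
    by blast
  show ?case
  proof (intro exI conjI allI impI)
    show "u permutes {m..n}" by (rule u)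
    show "tail_op n m a (frag_of u) = frag_of id"
      by (simp only: tail_op_Suc [OF m(2)] u w)
    fix b i
    assume i: "m \<le> i" "i \<le> n" "Poly_Mapping.lookup a i < Poly_Mapping.lookup b i"
      and eq: "\<forall>j<i. Poly_Mapping.lookup b j = Poly_Mapping.lookup a j"
    show "tail_op n m b (frag_of u) = 0"
    proof (cases "i = m")
      case True
      \<comment> \<open>The exponent exceeds \<open>u m - m\<close>, the number of times the value
        at \<open>m\<close> can drop.\<close>
      then have "(chevalley n m ^^ Poly_Mapping.lookup b m) (frag_of u) = 0"
        using u i m by (intro chevalley_pow_eq_0) auto
      then show ?thesis by (simp only: tail_op_Suc [OF m(2)] tail_op_0)
    next
      case False
      then have "Poly_Mapping.lookup b m = Poly_Mapping.lookup a m" using eq i by simp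
      then have "tail_op n m b (frag_of u) = tail_op n (Suc m) b (frag_of w)"
        by (simp only: tail_op_Suc [OF m(2)] u)
      also have "\<dots> = 0" using False i eq by (intro larger) auto
      finally show ?thesis .
    qed
  qed
qed

text \<open>Exponents are ordered lexicographically, so \<open>a < b\<close> provides a first index
  where \<open>b\<close> is larger, as \<open>tail_op_triangular\<close> requires.\<close>

lemma monom_op_triangular:
  assumes "a \<in> staircase n"
  obtains w where "w permutes {1..n}" "monom_op n (chevalley n) a (frag_of w) = frag_of id"
    "\<And>b. b \<in> staircase n \<Longrightarrow> a < b \<Longrightarrow> monom_op n (chevalley n) b (frag_of w) = 0"
proof -
  obtain w where w: "w permutes {1..n}" "tail_op n 1 a (frag_of w) = frag_of id"
    and larger: "\<And>b i. 1 \<le> i \<Longrightarrow> i \<le> n \<Longrightarrow> Poly_Mapping.lookup a i < Poly_Mapping.lookup b i \<Longrightarrow>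
      (\<forall>j<i. Poly_Mapping.lookup b j = Poly_Mapping.lookup a j) \<Longrightarrow> tail_op n 1 b (frag_of w) = 0"
    using tail_op_triangular [OF assms, of 1] by auto
  have op: "monom_op n (chevalley n) b x = tail_op n 1 b x" for b x
    by (simp add: monom_op_def tail_op_def)
  show ?thesis
  proof (rule that)
    show "w permutes {1..n}" by (rule w)
    show "monom_op n (chevalley n) a (frag_of w) = frag_of id" by (simp only: op w)
    fix b assume b: "b \<in> staircase n" "a < b"
    then obtain i where i: "Poly_Mapping.lookup a i < Poly_Mapping.lookup b i"
      "\<And>j. j < i \<Longrightarrow> Poly_Mapping.lookup a j = Poly_Mapping.lookup b j"
      by (auto simp: less_poly_mapping.rep_eq elim!: less_funE)
    \<comment> \<open>The exponent of \<open>b\<close> at \<open>i\<close> is positive, and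
      staircase exponents vanish outside \<open>{1..n}\<close>, so \<open>i\<close> is in
      range.\<close>
    have "Poly_Mapping.lookup b i \<le> (if i \<in> {1..n} then n - i else 0)"
      using b(1) unfolding staircase_def by blast
    with i(1) have "1 \<le> i" "i \<le> n" by (auto split: if_splits)
    then show "monom_op n (chevalley n) b (frag_of w) = 0"
      using i by (auto simp: op intro!: larger)
  qed
qed

text \<open>Test against the permutation attached to the lexicographically least exponent of
  \<open>h\<close>: the other monomials vanish on it, and the pairing is the coefficient at that
  exponent.\<close>

lemma staircase_pairing_nondegenerate:
  assumes h: "Poly_Mapping.keys h \<subseteq> staircase n"
    and pair: "\<And>w. w permutes {1..n} \<Longrightarrow> pair n h (frag_of w) = 0"
  shows "h = 0"
proof (rule ccontr)
  assume "h \<noteq> 0"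
  define a where "a = Min (Poly_Mapping.keys h)"
  have a: "a \<in> Poly_Mapping.keys h" using \<open>h \<noteq> 0\<close> by (simp add: a_def)
  with h obtain w where w: "w permutes {1..n}" "monom_op n (chevalley n) a (frag_of w) = frag_of id"
    "\<And>b. b \<in> staircase n \<Longrightarrow> a < b \<Longrightarrow> monom_op n (chevalley n) b (frag_of w) = 0"
    using monom_op_triangular [of a n] by blast
  have "monom_op n (chevalley n) b (frag_of w) = (if b = a then frag_of id else 0)"
    if "b \<in> Poly_Mapping.keys h" for b
    using w(2) w(3) [of b] that h by (auto simp: a_def order_less_le)
  then have "poly_op n (chevalley n) h (frag_of w) =
      frag_extend (\<lambda>b. if b = a then frag_of id else 0) h"
    unfolding poly_op_def by (rule frag_extend_eq)
  also have "\<dots> = (\<Sum>b\<in>Poly_Mapping.keys h. if b = a then frag_cmul (Poly_Mapping.lookup h a) (frag_of id) else 0)"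
    unfolding frag_extend_def by (rule sum.cong) auto
  also have "\<dots> = frag_cmul (Poly_Mapping.lookup h a) (frag_of id)"
    using a by simp
  finally have "pair n h (frag_of w) = Poly_Mapping.lookup h a"
    by (simp add: pair_def)
  with pair [OF w(1)] a show False by (simp add: in_keys_iff)
qed

section \<open>The grading by length\<close>

lemma chevalley_length:
  assumes "u \<in> Poly_Mapping.keys (chevalley n i x)"
  shows "\<exists>w\<in>Poly_Mapping.keys x. perm_length n u + 1 = perm_length n w"
proof -
  obtain j where "u \<in> Poly_Mapping.keys (cover_bracket n i j x)"
    using assms unfolding chevalley_def by (blast dest: subsetD [OF keys_sum])
  then obtain w where "w \<in> Poly_Mapping.keys x"
    "u \<in> Poly_Mapping.keys (cover_bracket n i j (frag_of w))"
    unfolding cover_bracket_def frag_extend_of using keys_frag_extend by fastforce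
  then show ?thesis
    by (auto simp: cover_bracket_def split: if_splits)
qed

lemma chevalley_pow_length:
  "u \<in> Poly_Mapping.keys ((chevalley n i ^^ p) x) \<Longrightarrow>
   \<exists>w\<in>Poly_Mapping.keys x. perm_length n u + p = perm_length n w"
proof (induction p arbitrary: u)
  case (Suc p)
  then obtain v where "v \<in> Poly_Mapping.keys ((chevalley n i ^^ p) x)"
    "perm_length n u + 1 = perm_length n v"
    using chevalley_length [of u n i "(chevalley n i ^^ p) x"] by auto
  with Suc.IH [of v] obtain w where "w \<in> Poly_Mapping.keys x"
    "perm_length n u + Suc p = perm_length n w" by auto
  then show ?case by (intro bexI [of _ w])
next
  case 0
  then show ?case by (intro bexI [of _ u]) simp_all
qed

lemma monom_op_length:
  assumes "u \<in> Poly_Mapping.keys (monom_op n (chevalley n) m (frag_of w))"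
  shows "perm_length n u + (\<Sum>i\<in>{1..n}. Poly_Mapping.lookup m i) = perm_length n w"
proof -
  have "\<exists>w\<in>Poly_Mapping.keys x. perm_length n u + sum_list (map (Poly_Mapping.lookup m) js) = perm_length n w"
    if "u \<in> Poly_Mapping.keys (foldl (\<lambda>y i. (chevalley n i ^^ Poly_Mapping.lookup m i) y) x js)" for x js
    using that
  proof (induction js arbitrary: x)
    case (Cons j js)
    then obtain v where "v \<in> Poly_Mapping.keys ((chevalley n j ^^ Poly_Mapping.lookup m j) x)"
      "perm_length n u + sum_list (map (Poly_Mapping.lookup m) js) = perm_length n v"
      by auto
    with chevalley_pow_length [where u = v] show ?case by (force simp: add_ac)
  next
    case Nil
    then show ?case by (intro bexI [of _ u]) simp_all
  qed
  from this [of "frag_of w" "[1..<Suc n]"] assms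
  have "perm_length n u + sum_list (map (Poly_Mapping.lookup m) [1..<Suc n]) = perm_length n w"
    by (simp add: monom_op_def del: upt_Suc)
  moreover have "set [1..<Suc n] = {1..n}" by auto
  ultimately show ?thesis
    using sum_list_distinct_conv_sum_set [OF distinct_upt, of "Poly_Mapping.lookup m" 1 "Suc n"]
    by (simp only:)
qed

section \<open>The staircase monomial; duality, uniqueness and existence of Schubert
  polynomials\<close>

lemma var_power: "var i ^ p = frag_of (Poly_Mapping.single i p)"
proof (induction p)
  case (Suc p)
  have "Poly_Mapping.single i (Suc p) = Poly_Mapping.single i p + Poly_Mapping.single i 1"
    by (simp add: Suc_eq_plus1 flip: single_add)
  with Suc show ?case by (simp add: var_mult_frag_of)
qed simp

lemma prod_frag_of: "(\<Prod>i\<in>I. frag_of (g i)) = (frag_of (\<Sum>i\<in>I. g i) :: ipoly)"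
  by (induction I rule: infinite_finite_induct) (simp_all add: mult_single)

definition delta :: "nat \<Rightarrow> (nat \<Rightarrow>\<^sub>0 nat)" where
  "delta n = (\<Sum>i\<in>{1..<n}. Poly_Mapping.single i (n - i))"

lemma lookup_delta: "Poly_Mapping.lookup (delta n) i = (if i \<in> {1..<n} then n - i else 0)"
  by (simp add: delta_def lookup_sum lookup_single when_def)

lemma schubert_longest: "(\<Prod>i\<in>{1..<n}. var i ^ (n - i)) = frag_of (delta n)"
  by (simp add: var_power prod_frag_of delta_def)

lemma delta_staircase: "delta n \<in> staircase n"
  by (simp add: staircase_def lookup_delta)

lemma sum_delta: "(\<Sum>i\<in>{1..n}. Poly_Mapping.lookup (delta n) i) = (\<Sum>i\<in>{1..<n}. n - i)"
  by (rule sum.mono_neutral_cong_right) (auto simp: lookup_delta)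

text \<open>By degree, only a permutation of maximal length, hence the longest one, can pair
  nontrivially. The value 1 comes from the triangularity witness, which is the longest permutation
  by the same count.\<close>

lemma pair_delta:
  assumes u: "u permutes {1..n}"
  shows "pair n (frag_of (delta n)) (frag_of u) = (if u = longest_perm n then 1 else 0)"
proof -
  have *: "w = longest_perm n"
    if "w permutes {1..n}" "id \<in> Poly_Mapping.keys (monom_op n (chevalley n) (delta n) (frag_of w))" for w
    using monom_op_length [OF that(2)] that(1)
    by (intro perm_length_eq_max) (simp_all add: perm_length_id sum_delta)
  obtain w where w: "w permutes {1..n}" "monom_op n (chevalley n) (delta n) (frag_of w) = frag_of id"
    by (rule monom_op_triangular [OF delta_staircase [of n]])
  then have "w = longest_perm n" by (intro *) simp_all
  show ?thesis
  proof (cases "u = longest_perm n")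
    case True
    with w(2) \<open>w = longest_perm n\<close> show ?thesis
      by (simp add: pair_def poly_op_frag_of)
  next
    case False
    then have "id \<notin> Poly_Mapping.keys (monom_op n (chevalley n) (delta n) (frag_of u))"
      using * [OF u] by blast
    with False show ?thesis by (simp add: pair_def poly_op_frag_of in_keys_iff)
  qed
qed

text \<open>Adjointness of \<open>bgg\<close> and \<open>divided_diff\<close> carries duality down
  from the longest permutation. The bound on exponents comes along because uniqueness relies on
  it.\<close>

lemma is_schubert_pair:
  assumes "is_schubert n w f"
  shows "w permutes {1..n} \<and> Poly_Mapping.keys f \<subseteq> staircase n \<and>
    (\<forall>u. u permutes {1..n} \<longrightarrow> pair n f (frag_of u) = (if u = w then 1 else 0))"
  using assms
proof induction
  case longest
  show ?case
    unfolding schubert_longest using pair_delta longest_perm_permutes delta_staircase by simp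
next
  case (descend w f k)
  let ?s = "transpose k (Suc k)"
  have w: "w permutes {1..n}" and f: "Poly_Mapping.keys f \<subseteq> staircase n"
    and pair: "\<And>u. u permutes {1..n} \<Longrightarrow> pair n f (frag_of u) = (if u = w then 1 else 0)"
    using descend.IH by auto
  have "pair n (divided_diff k f) (frag_of u) = (if u = w \<circ> ?s then 1 else 0)"
    if u: "u permutes {1..n}" for u
  proof -
    have "pair n (divided_diff k f) (frag_of u) = pair n f (bgg n k (frag_of u))"
      using u descend.hyps(2) by (simp add: pair_bgg)
    also have "\<dots> = (if perm_length n u < perm_length n (u \<circ> ?s)
        then pair n f (frag_of (u \<circ> ?s)) else 0)"
      by (simp add: bgg_def Let_def)
    also have "\<dots> = (if perm_length n u < perm_length n (u \<circ> ?s) \<and> u \<circ> ?s = w then 1 else 0)"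
      unfolding pair [OF permutes_simple_swap [OF u descend.hyps(2)]] by (simp only: if_if_eq_conj)
    also have "u \<circ> ?s = w \<longleftrightarrow> u = w \<circ> ?s"
      by (auto simp: comp_assoc)
    \<comment> \<open>The length condition of \<open>bgg\<close> is the descent condition of the
      recursion.\<close>
    also have "perm_length n u < perm_length n (u \<circ> ?s) \<and> u = w \<circ> ?s \<longleftrightarrow> u = w \<circ> ?s"
      using descend.hyps(3) by (auto simp: comp_assoc)
    finally show ?thesis .
  qed
  with permutes_simple_swap [OF w descend.hyps(2)]
    keys_divided_diff [OF f exponent_closed_staircase [OF descend.hyps(2)]]
  show ?case by (intro conjI allI impI)
qed

text \<open>All chains of descents to \<open>w\<close> yield the same pairings, and nondegeneracy
  turns this into equality; \<open>schubert\<close> is thereby well defined.\<close>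

lemma is_schubert_unique:
  assumes "is_schubert n w f" "is_schubert n w g"
  shows "f = g"
proof -
  note f = is_schubert_pair [OF assms(1)] and g = is_schubert_pair [OF assms(2)]
  have "f - g = 0"
  proof (rule staircase_pairing_nondegenerate)
    show "Poly_Mapping.keys (f - g) \<subseteq> staircase n"
      using f g keys_diff [of f g] by blast
    show "pair n (f - g) (frag_of u) = 0" if "u permutes {1..n}" for u
      using f g that by (simp add: pair_diff_left)
  qed
  then show ?thesis by simp
qed

text \<open>Climb by ascents to the longest permutation; the measure is the length still
  missing.\<close>

lemma is_schubert_exists: "w permutes {1..n} \<Longrightarrow> \<exists>f. is_schubert n w f"
proof (induction "(\<Sum>i\<in>{1..<n}. n - i) - perm_length n w" arbitrary: w rule: less_induct)
  case less
  show ?case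
  proof (cases "w = longest_perm n")
    case True
    then show ?thesis using is_schubert.longest by blast
  next
    case False
    then obtain k where k: "k \<in> {1..<n}" "\<not> w (Suc k) < w k"
      using permutes_no_ascent [OF less.prems] by blast
    define u where "u = w \<circ> transpose k (Suc k)"
    have u: "u permutes {1..n}" unfolding u_def by (rule permutes_simple_swap [OF less.prems k(1)])
    have w: "w = u \<circ> transpose k (Suc k)" by (simp add: u_def comp_assoc)
    have len: "perm_length n w < perm_length n u"
      unfolding u_def
      by (rule perm_length_simple_cases [OF k(1) permutes_inj [OF less.prems]]) (use k(2) in auto)
    with perm_length_le_max [of n u] obtain f where "is_schubert n u f"
      using less.hyps [OF _ u] by fastforce
    from is_schubert.descend [OF this k(1)] len show ?thesis by (auto simp flip: w)
  qed
qed

lemma is_schubert_schubert: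
  assumes "w permutes {1..n}"
  shows "is_schubert n w (schubert n w)"
  unfolding schubert_def
  using is_schubert_exists [OF assms] is_schubert_unique by (metis the_equality)

lemma pair_schubert:
  assumes "supported n x" "v permutes {1..n}"
  shows "pair n (schubert n v) x = Poly_Mapping.lookup x v"
  using assms(1)
proof (induction rule: supported_induct)
  case (perm w)
  then show ?case
    using is_schubert_pair [OF is_schubert_schubert [OF assms(2)]] by auto
qed (simp_all add: pair_diff_right lookup_minus)

text \<open>Schubert polynomials read off coefficients, and by \<open>is_csm_pair\<close> these
  depend on \<open>w\<close> alone. Hence all derivations of \<open>is_csm\<close> for
  \<open>w\<close> give the same class.\<close>

lemma lookup_csm:
  assumes "w permutes {1..n}" "v permutes {1..n}"
  shows "Poly_Mapping.lookup (csm n w) v = dunkl_functional n (schubert n v) (frag_of w)"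
proof -
  have eq: "Poly_Mapping.lookup x v = dunkl_functional n (schubert n v) (frag_of w)"
    if "is_csm n w x" "v permutes {1..n}" for x v
    using is_csm_pair [OF that(1)] pair_schubert [OF _ that(2)] by simp
  have "x = y" if x: "is_csm n w x" and y: "is_csm n w y" for x y
  proof (rule poly_mapping_eqI)
    fix v
    show "Poly_Mapping.lookup x v = Poly_Mapping.lookup y v"
    proof (cases "v permutes {1..n}")
      case True
      then show ?thesis using eq x y by simp
    next
      case False
      then show ?thesis
        using is_csm_pair [OF x] is_csm_pair [OF y] unfolding supported_def
        by (metis in_keys_iff)
    qed
  qed
  then have "is_csm n w (csm n w)"
    unfolding csm_def using is_csm_exists [OF assms(1)] by (metis the_equality)
  then show ?thesis using assms(2) by (rule eq)
qed

section \<open>The action of the Fomin--Kirillov algebra\<close>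

lemma bracket_frag_of: "bracket i j (frag_of w) = frag_cmul (swap_sign w i j) (frag_of (w \<circ> transpose i j))"
  by (simp add: bracket_def)

lemma bracket_bracket_frag_of:
  "bracket k l (bracket i j (frag_of w)) =
    frag_cmul (swap_sign w i j * swap_sign (w \<circ> transpose i j) k l)
      (frag_of (w \<circ> (transpose i j \<circ> transpose k l)))"
  by (simp add: bracket_def frag_extend_cmul comp_assoc)

lemmas bracket_linear = diff_imp_linear [of "bracket i j" for i j, OF bracket_diff]

text \<open>After one nonzero step the positions \<open>i\<close> and \<open>j\<close> are no longer
  inverted.\<close>

lemma bracket_square:
  assumes "supported n x" "i \<noteq> j"
  shows "bracket i j (bracket i j x) = 0"
  using assms(1)
proof (induction rule: supported_induct)
  case (perm w)
  have "swap_sign w i j * swap_sign (w \<circ> transpose i j) i j = 0"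
    by (simp add: swap_sign_def)
  then show ?case by (simp add: bracket_bracket_frag_of)
qed (simp_all add: bracket_linear bracket_diff)

lemma bracket_commute:
  assumes "supported n x" "distinct [i, j, k, l]"
  shows "bracket k l (bracket i j x) = bracket i j (bracket k l x)"
  using assms(1)
proof (induction rule: supported_induct)
  case (perm w)
  have "transpose i j \<circ> transpose k l = transpose k l \<circ> transpose i j"
    using assms(2) transpose_conjugate [of k l i j] by simp
  moreover have "swap_sign (w \<circ> transpose i j) k l = swap_sign w k l"
    "swap_sign (w \<circ> transpose k l) i j = swap_sign w i j"
    using assms(2) by (simp_all add: swap_sign_def)
  ultimately show ?case by (simp add: bracket_bracket_frag_of mult.commute)
qed (simp_all add: bracket_linear bracket_diff)

text \<open>All words of a triangle relation thus move \<open>w\<close> to the same permutation, and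
  the relation reduces to signs.\<close>

lemma transpose_triangle:
  assumes "distinct [i, j, k]"
  shows "transpose i j \<circ> transpose j k = transpose j k \<circ> transpose i k"
    "transpose i j \<circ> transpose j k = transpose i k \<circ> transpose i j"
    "transpose j k \<circ> transpose i j = transpose i k \<circ> transpose j k"
    "transpose j k \<circ> transpose i j = transpose i j \<circ> transpose i k"
proof -
  have neq: "i \<noteq> j" "j \<noteq> i" "i \<noteq> k" "k \<noteq> i" "j \<noteq> k" "k \<noteq> j"
    using assms by auto
  show "transpose i j \<circ> transpose j k = transpose j k \<circ> transpose i k"
    "transpose i j \<circ> transpose j k = transpose i k \<circ> transpose i j"
    "transpose j k \<circ> transpose i j = transpose i k \<circ> transpose j k"
    "transpose j k \<circ> transpose i j = transpose i j \<circ> transpose i k"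
    using transpose_conjugate [of i j j k] transpose_conjugate [of j k i k]
      transpose_conjugate [of j k i j] transpose_conjugate [of i j i k]
    by (simp_all add: neq)
qed

text \<open>Taking two values instead of a permutation makes the sign after a swap the same function
  at permuted arguments.\<close>

definition inversion_sign :: "nat \<Rightarrow> nat \<Rightarrow> nat \<Rightarrow> nat \<Rightarrow> int" where
  "inversion_sign i j a b = (if i < j \<and> b < a then 1 else if j < i \<and> a < b then - 1 else 0)"

lemma swap_sign_inversion_sign: "swap_sign w i j = inversion_sign i j (w i) (w j)"
  by (simp add: swap_sign_def inversion_sign_def)

text \<open>\<open>a\<close>, \<open>b\<close>, \<open>c\<close> are the values at \<open>i\<close>,
  \<open>j\<close>, \<open>k\<close>, and the second factor of each product sees them after the
  first swap. Only relative orders matter, which leaves finitely many cases.\<close>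

lemma inversion_sign_triangle:
  assumes "i \<noteq> j" "i \<noteq> k" "j \<noteq> k" "a \<noteq> b" "a \<noteq> c" "b \<noteq> c"
  shows "inversion_sign i j a b * inversion_sign j k a c =
      inversion_sign j k b c * inversion_sign i k a b + inversion_sign i k a c * inversion_sign i j c b"
    "inversion_sign j k b c * inversion_sign i j a c =
      inversion_sign i k a c * inversion_sign j k b a + inversion_sign i j a b * inversion_sign i k b c"
  using assms unfolding inversion_sign_def by auto

text \<open>In a right action \<open>[ij][jk]\<close> is \<open>bracket i j\<close> followed by
  \<open>bracket j k\<close>, so nesting reverses the written order of the relation.\<close>

lemma bracket_triangle:
  assumes "supported n x" "distinct [i, j, k]"
  shows "bracket j k (bracket i j x) = bracket i k (bracket j k x) + bracket i j (bracket i k x)"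
  using assms(1)
proof (induction rule: supported_induct)
  case (perm w)
  have neq: "w i \<noteq> w j" "w i \<noteq> w k" "w j \<noteq> w k"
    using assms(2) inj_eq [OF permutes_inj [OF perm]] by simp_all
  have "swap_sign w i j * swap_sign (w \<circ> transpose i j) j k =
      swap_sign w j k * swap_sign (w \<circ> transpose j k) i k +
      swap_sign w i k * swap_sign (w \<circ> transpose i k) i j"
    using assms(2) neq inversion_sign_triangle(1) [of i j k "w i" "w j" "w k"]
    by (auto simp: swap_sign_inversion_sign)
  then show ?case
    using transpose_triangle(1,2) [OF assms(2)]
    by (simp add: bracket_bracket_frag_of flip: frag_cmul_distrib)
qed (simp_all add: bracket_linear bracket_diff)

lemma bracket_triangle':
  assumes "supported n x" "distinct [i, j, k]"
  shows "bracket i j (bracket j k x) = bracket j k (bracket i k x) + bracket i k (bracket i j x)"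
  using assms(1)
proof (induction rule: supported_induct)
  case (perm w)
  have neq: "w i \<noteq> w j" "w i \<noteq> w k" "w j \<noteq> w k"
    using assms(2) inj_eq [OF permutes_inj [OF perm]] by simp_all
  have "swap_sign w j k * swap_sign (w \<circ> transpose j k) i j =
      swap_sign w i k * swap_sign (w \<circ> transpose i k) j k +
      swap_sign w i j * swap_sign (w \<circ> transpose i j) i k"
    using assms(2) neq inversion_sign_triangle(2) [of i j k "w i" "w j" "w k"]
    by (auto simp: swap_sign_inversion_sign)
  then show ?case
    using transpose_triangle(3,4) [OF assms(2)]
    by (simp add: bracket_bracket_frag_of flip: frag_cmul_distrib)
qed (simp_all add: bracket_linear bracket_diff)

lemma bracket_is_supported:
  "supported n x \<Longrightarrow> i \<in> {1..n} \<Longrightarrow> j \<in> {1..n} \<Longrightarrow> supported n (bracket i j x)"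
  by (rule supported_linear) (auto simp: bracket_diff bracket_supported)

section \<open>The action of the free ring and its annihilator\<close>

lemma bruhat_letter_diff: "bruhat_letter n (x - y) p = bruhat_letter n x p - bruhat_letter n y p"
  by (cases p) (simp add: bruhat_letter_def frag_extend_diff)

lemma bruhat_letter_bracket:
  assumes "supported n x" "1 \<le> i" "i < j" "j \<le> n"
  shows "bruhat_letter n x (i, j) = bracket i j x"
  using assms(1)
proof (induction rule: supported_induct)
  case (perm w)
  have "perm_length n (w \<circ> transpose i j) < perm_length n w \<longleftrightarrow> w j < w i"
    using assms by (intro perm_length_transpose_less_iff permutes_inj [OF perm])
  then show ?case using assms by (simp add: bruhat_letter_def bracket_frag_of swap_sign_def)
qed (simp_all add: bruhat_letter_diff bracket_diff bracket_linear
    diff_imp_linear(1) [of "\<lambda>x. bruhat_letter n x p" for p, OF bruhat_letter_diff])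

lemma bracket_antisym:
  assumes "i \<noteq> j"
  shows "bracket i j x = - bracket j i x"
proof -
  have "swap_sign w i j = - swap_sign w j i" for w
    using assms by (auto simp: swap_sign_def)
  moreover have "transpose i j = transpose j i" by (rule transpose_commute)
  ultimately have "bracket i j (frag_of w) = - bracket j i (frag_of w)" for w
    by (simp add: bracket_frag_of)
  then show ?thesis
    by (induction x rule: frag_induction [OF subset_UNIV]) (simp_all add: bracket_linear bracket_diff)
qed

lemma bruhat_free_0 [simp]: "bruhat_free n x 0 = 0"
  and bruhat_free_diff: "bruhat_free n x (a - b) = bruhat_free n x a - bruhat_free n x b"
  and bruhat_free_add: "bruhat_free n x (a + b) = bruhat_free n x a + bruhat_free n x b"
  and bruhat_free_minus: "bruhat_free n x (- a) = - bruhat_free n x a"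
  and bruhat_free_frag_of: "bruhat_free n x (frag_of u) = foldl (bruhat_letter n) x (letters u)"
  by (simp_all add: bruhat_free_def frag_extend_diff frag_extend_add frag_extend_minus)

lemma foldl_bruhat_letter_diff:
  "foldl (bruhat_letter n) (x - y) ps = foldl (bruhat_letter n) x ps - foldl (bruhat_letter n) y ps"
  by (induction ps arbitrary: x y) (simp_all add: bruhat_letter_diff)

lemma bruhat_free_diff_right: "bruhat_free n (x - y) a = bruhat_free n x a - bruhat_free n y a"
  by (simp add: bruhat_free_def foldl_bruhat_letter_diff frag_extend_minus_fun)

lemma bruhat_free_0_right [simp]: "bruhat_free n 0 a = 0"
  using bruhat_free_diff_right [of n 0 0 a] by simp

lemma bruhat_free_mult: "bruhat_free n x (a * b) = bruhat_free n (bruhat_free n x a) b"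
proof (induction a rule: frag_induction [OF subset_UNIV])
  case (2 u)
  show ?case
  proof (induction b rule: frag_induction [OF subset_UNIV])
    case (2 v)
    show ?case by (simp add: mult_single bruhat_free_frag_of plus_fk_word_def)
  qed (simp_all add: right_diff_distrib bruhat_free_diff)
qed (simp_all add: left_diff_distrib bruhat_free_diff bruhat_free_diff_right)

lemma bruhat_free_one: "bruhat_free n x 1 = x"
proof -
  have "bruhat_free n x (frag_of 0) = x"
    unfolding bruhat_free_frag_of by (simp add: zero_fk_word_def)
  then show ?thesis by simp
qed

lemma bruhat_free_gen:
  assumes "supported n x" "i \<in> {1..n}" "j \<in> {1..n}" "i \<noteq> j"
  shows "bruhat_free n x (free_gen i j) = bracket i j x"
  using assms bracket_antisym [OF assms(4), of x]
  by (auto simp: free_gen_def bruhat_free_minus bruhat_free_frag_of bruhat_letter_bracket)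

lemma free_ring_simps:
  "mult (free_ring n) = (*)" "add (free_ring n) = (+)" "one (free_ring n) = 1" "zero (free_ring n) = 0"
  by (simp_all add: free_ring_def)

lemma bruhat_free_supported:
  assumes "a \<in> carrier (free_ring n)" "supported n x"
  shows "supported n (bruhat_free n x a)"
proof -
  have "supported n (foldl (bruhat_letter n) x ps)" if "set ps \<subseteq> fk_letters n" for ps
    using that assms(2)
  proof (induction ps arbitrary: x)
    case (Cons p ps)
    then have "supported n (bruhat_letter n x p)"
      by (cases p) (auto simp: fk_letters_def bruhat_letter_bracket intro!: bracket_is_supported)
    with Cons show ?case by simp
  qed simp
  then show ?thesis
    using assms(1) unfolding bruhat_free_def supported_def free_ring_def
    by (fastforce dest!: subsetD [OF keys_frag_extend])
qed

lemma free_gen_closed: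
  assumes "i \<in> {1..n}" "j \<in> {1..n}" "i \<noteq> j"
  shows "free_gen i j \<in> carrier (free_ring n)"
  using assms by (auto simp: free_gen_def free_ring_def fk_letters_def)

text \<open>The annihilator of Z[S_n]. As an ideal containing the relators it contains
  \<open>fk_ideal n\<close>, so the action descends to \<open>FK n\<close>.\<close>

definition bruhat_kernel :: "nat \<Rightarrow> (fk_word \<Rightarrow>\<^sub>0 int) set" where
  "bruhat_kernel n = {a \<in> carrier (free_ring n). \<forall>x. supported n x \<longrightarrow> bruhat_free n x a = 0}"

lemma ideal_bruhat_kernel: "ideal (bruhat_kernel n) (free_ring n)"
proof -
  interpret R: ring "free_ring n" by (rule ring_free_ring)
  have neg: "\<ominus>\<^bsub>free_ring n\<^esub> a = - a" if "a \<in> carrier (free_ring n)" for a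
    using that by (intro R.minus_equality) (auto simp: free_ring_def)
  show ?thesis
  proof (rule idealI)
    show "ring (free_ring n)" by (rule ring_free_ring)
    show "subgroup (bruhat_kernel n) (add_monoid (free_ring n))"
    proof (rule R.add.subgroupI)
      show "bruhat_kernel n \<noteq> {}"
        using R.zero_closed by (auto simp: bruhat_kernel_def free_ring_simps)
      show "\<ominus>\<^bsub>free_ring n\<^esub> a \<in> bruhat_kernel n" if "a \<in> bruhat_kernel n" for a
        using that R.a_inv_closed [of a] by (simp add: bruhat_kernel_def neg bruhat_free_minus)
      show "a \<oplus>\<^bsub>free_ring n\<^esub> b \<in> bruhat_kernel n"
        if "a \<in> bruhat_kernel n" "b \<in> bruhat_kernel n" for a b
        using that R.add.m_closed [of a b]
        by (simp add: bruhat_kernel_def bruhat_free_add free_ring_simps)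
    qed (auto simp: bruhat_kernel_def)
    fix a b assume ab: "a \<in> bruhat_kernel n" "b \<in> carrier (free_ring n)"
    \<comment> \<open>Here \<open>b\<close> acts first, and its result stays in Z[S_n], where
      \<open>a\<close> acts as zero.\<close>
    show "b \<otimes>\<^bsub>free_ring n\<^esub> a \<in> bruhat_kernel n"
      using ab R.m_closed [of b a]
      by (simp add: bruhat_kernel_def free_ring_simps bruhat_free_mult bruhat_free_supported)
    show "a \<otimes>\<^bsub>free_ring n\<^esub> b \<in> bruhat_kernel n"
      using ab R.m_closed [of a b] by (simp add: bruhat_kernel_def free_ring_simps bruhat_free_mult)
  qed
qed

lemma carrier_closed:
  assumes "a \<in> carrier (free_ring n)" "b \<in> carrier (free_ring n)"
  shows "a * b \<in> carrier (free_ring n)" "a + b \<in> carrier (free_ring n)"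
    "a - b \<in> carrier (free_ring n)"
proof -
  interpret R: ring "free_ring n" by (rule ring_free_ring)
  have *: "- b \<in> carrier (free_ring n)"
    using assms(2) by (simp add: free_ring_def)
  show "a * b \<in> carrier (free_ring n)" "a + b \<in> carrier (free_ring n)"
    "a - b \<in> carrier (free_ring n)"
    using R.m_closed [OF assms] R.add.m_closed [OF assms] R.add.m_closed [OF assms(1) *]
    by (simp_all add: free_ring_simps)
qed

lemma relators_bruhat_kernel: "fk_relators n \<subseteq> bruhat_kernel n"
  unfolding fk_relators_def bruhat_kernel_def
  by (auto simp: carrier_closed free_gen_closed bruhat_free_mult bruhat_free_diff bruhat_free_add
      bruhat_free_gen bracket_is_supported bracket_square
      bracket_commute bracket_triangle bracket_triangle')

lemma fk_relators_closed: "fk_relators n \<subseteq> carrier (free_ring n)"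
  using relators_bruhat_kernel by (auto simp: bruhat_kernel_def)

lemma ideal_fk_ideal: "ideal (fk_ideal n) (free_ring n)"
  unfolding fk_ideal_def by (rule ring.genideal_ideal [OF ring_free_ring fk_relators_closed])

lemma fk_ideal_bruhat_kernel: "fk_ideal n \<subseteq> bruhat_kernel n"
  unfolding fk_ideal_def
  by (rule ring.genideal_minimal [OF ring_free_ring ideal_bruhat_kernel relators_bruhat_kernel])

text \<open>Members of a coset differ by an element acting as zero, and the coset contains
  \<open>a\<close>, so \<open>the_elem\<close> is applied to a singleton.\<close>

lemma bruhat_act_coset:
  assumes x: "supported n x" and a: "a \<in> carrier (free_ring n)"
  shows "bruhat_act n x (fk_ideal n +>\<^bsub>free_ring n\<^esub> a) = bruhat_free n x a"
proof -
  interpret I: ideal "fk_ideal n" "free_ring n" by (rule ideal_fk_ideal)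
  have eq: "bruhat_free n x b = bruhat_free n x a" if "b \<in> fk_ideal n +>\<^bsub>free_ring n\<^esub> a" for b
  proof -
    have "b \<in> (\<Union>h\<in>fk_ideal n. {h + a})"
      using that by (simp only: a_r_coset_def' free_ring_simps)
    then obtain h where "h \<in> fk_ideal n" and b: "b = h + a"
      by (elim UN_E singletonE)
    then have "bruhat_free n x h = 0"
      using subsetD [OF fk_ideal_bruhat_kernel] x by (simp add: bruhat_kernel_def)
    then show ?thesis by (simp add: b bruhat_free_add)
  qed
  have "bruhat_free n x ` (fk_ideal n +>\<^bsub>free_ring n\<^esub> a) =
      (\<lambda>_. bruhat_free n x a) ` (fk_ideal n +>\<^bsub>free_ring n\<^esub> a)"
    using eq by (rule image_cong [OF refl])
  also have "\<dots> = {bruhat_free n x a}"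
    by (rule image_constant [OF I.a_rcos_self [OF a]])
  finally have "bruhat_free n x ` (fk_ideal n +>\<^bsub>free_ring n\<^esub> a) = {bruhat_free n x a}" .
  then show ?thesis by (simp add: bruhat_act_def)
qed

section \<open>The action of the quotient ring\<close>

lemma ring_FK: "ring (FK n)"
  unfolding FK_def by (rule ideal.quotient_is_ring [OF ideal_fk_ideal])

lemma FK_coset_hom: "(\<lambda>a. fk_ideal n +>\<^bsub>free_ring n\<^esub> a) \<in> ring_hom (free_ring n) (FK n)"
  unfolding FK_def by (rule ideal.rcos_ring_hom [OF ideal_fk_ideal])

lemma FK_carrierE:
  assumes "A \<in> carrier (FK n)"
  obtains a where "a \<in> carrier (free_ring n)" "A = fk_ideal n +>\<^bsub>free_ring n\<^esub> a"
  using assms by (auto simp: FK_def FactRing_def A_RCOSETS_def')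

lemma bruhat_act_add:
  assumes x: "supported n x" and "A \<in> carrier (FK n)" "B \<in> carrier (FK n)"
  shows "bruhat_act n x (A \<oplus>\<^bsub>FK n\<^esub> B) = bruhat_act n x A + bruhat_act n x B"
proof -
  obtain a b where ab: "a \<in> carrier (free_ring n)" "A = fk_ideal n +>\<^bsub>free_ring n\<^esub> a"
    "b \<in> carrier (free_ring n)" "B = fk_ideal n +>\<^bsub>free_ring n\<^esub> b"
    using assms by (meson FK_carrierE)
  then have "A \<oplus>\<^bsub>FK n\<^esub> B = fk_ideal n +>\<^bsub>free_ring n\<^esub> (a + b)"
    using ring_hom_add [OF FK_coset_hom ab(1,3)] by (simp add: free_ring_simps)
  then show ?thesis
    using ab x by (simp add: bruhat_act_coset carrier_closed bruhat_free_add)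
qed

lemma bruhat_act_mult:
  assumes x: "supported n x" and "A \<in> carrier (FK n)" "B \<in> carrier (FK n)"
  shows "bruhat_act n x (A \<otimes>\<^bsub>FK n\<^esub> B) = bruhat_act n (bruhat_act n x A) B"
proof -
  obtain a b where ab: "a \<in> carrier (free_ring n)" "A = fk_ideal n +>\<^bsub>free_ring n\<^esub> a"
    "b \<in> carrier (free_ring n)" "B = fk_ideal n +>\<^bsub>free_ring n\<^esub> b"
    using assms by (meson FK_carrierE)
  then have "A \<otimes>\<^bsub>FK n\<^esub> B = fk_ideal n +>\<^bsub>free_ring n\<^esub> (a * b)"
    using ring_hom_mult [OF FK_coset_hom ab(1,3)] by (simp add: free_ring_simps)
  then show ?thesis
    using ab x by (simp add: bruhat_act_coset carrier_closed bruhat_free_mult bruhat_free_supported)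
qed

lemma bruhat_act_one:
  assumes "supported n x"
  shows "bruhat_act n x \<one>\<^bsub>FK n\<^esub> = x"
  using bruhat_act_coset [OF assms, of 1] ring_hom_one [OF FK_coset_hom, of n]
    ring.ring_simprules(6) [OF ring_free_ring, of n]
  by (simp add: free_ring_simps bruhat_free_one)

lemma bruhat_act_zero:
  assumes "supported n x"
  shows "bruhat_act n x \<zero>\<^bsub>FK n\<^esub> = 0"
proof -
  interpret F: ring "FK n" by (rule ring_FK)
  show ?thesis using bruhat_act_add [OF assms F.zero_closed F.zero_closed] by simp
qed

lemma bruhat_act_neg:
  assumes "supported n x" "A \<in> carrier (FK n)"
  shows "bruhat_act n x (\<ominus>\<^bsub>FK n\<^esub> A) = - bruhat_act n x A"
proof -
  interpret F: ring "FK n" by (rule ring_FK)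
  have "bruhat_act n x (\<ominus>\<^bsub>FK n\<^esub> A) + bruhat_act n x A = 0"
    using bruhat_act_add [OF assms(1) F.a_inv_closed [OF assms(2)] assms(2)]
    by (simp add: F.l_neg assms bruhat_act_zero)
  then show ?thesis by (simp add: eq_neg_iff_add_eq_0)
qed

lemma bruhat_act_add_pow_nat:
  assumes "supported n x" "A \<in> carrier (FK n)"
  shows "bruhat_act n x (add_pow (FK n) (k :: nat) A) = frag_cmul (int k) (bruhat_act n x A)"
proof -
  interpret F: ring "FK n" by (rule ring_FK)
  show ?thesis
  proof (induction k)
    case 0
    show ?case by (simp add: bruhat_act_zero assms)
  next
    case (Suc k)
    have "bruhat_act n x (add_pow (FK n) (Suc k) A) =
        bruhat_act n x (add_pow (FK n) k A) + bruhat_act n x A"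
      unfolding F.add.nat_pow_Suc using assms by (intro bruhat_act_add F.add.nat_pow_closed)
    moreover have "frag_cmul (int (Suc k)) y = frag_cmul (int k) y + y" for y :: homology
      using frag_cmul_distrib [of "int k" 1 y] by (simp add: add.commute)
    ultimately show ?case using Suc by simp
  qed
qed

lemma bruhat_act_add_pow:
  assumes "supported n x" "A \<in> carrier (FK n)"
  shows "bruhat_act n x (add_pow (FK n) (k :: int) A) = frag_cmul k (bruhat_act n x A)"
proof -
  interpret F: ring "FK n" by (rule ring_FK)
  show ?thesis
    using assms
    by (cases "0 \<le> k") (simp_all add: add_pow_int_ge add_pow_int_lt bruhat_act_add_pow_nat bruhat_act_neg)
qed

lemma bruhat_act_finsum:
  assumes "supported n x" "finite J" "f \<in> J \<rightarrow> carrier (FK n)"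
  shows "bruhat_act n x (finsum (FK n) f J) = (\<Sum>j\<in>J. bruhat_act n x (f j))"
proof -
  interpret F: ring "FK n" by (rule ring_FK)
  show ?thesis
    using assms(2,3)
    by (induction J) (simp_all add: assms(1) bruhat_act_zero bruhat_act_add F.finsum_insert Pi_iff)
qed

section \<open>Dunkl elements and the evaluation of polynomials at them\<close>

lemma fk_gen_closed:
  "i \<in> {1..n} \<Longrightarrow> j \<in> {1..n} \<Longrightarrow> i \<noteq> j \<Longrightarrow> fk_gen n i j \<in> carrier (FK n)"
  unfolding fk_gen_def by (rule ring_hom_closed [OF FK_coset_hom free_gen_closed])

lemma bruhat_act_fk_gen:
  assumes "supported n x" "i \<in> {1..n}" "j \<in> {1..n}" "i \<noteq> j"
  shows "bruhat_act n x (fk_gen n i j) = bracket i j x"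
  unfolding fk_gen_def using assms
  by (simp only: bruhat_act_coset free_gen_closed bruhat_free_gen not_False_eq_True)

lemma dunkl_closed: "i \<in> {1..n} \<Longrightarrow> dunkl n i \<in> carrier (FK n)"
proof -
  interpret F: ring "FK n" by (rule ring_FK)
  show "i \<in> {1..n} \<Longrightarrow> dunkl n i \<in> carrier (FK n)"
    unfolding dunkl_def by (intro F.finsum_closed) (auto intro: fk_gen_closed)
qed

lemma bruhat_act_dunkl:
  assumes "supported n x" "i \<in> {1..n}"
  shows "bruhat_act n x (dunkl n i) = dunkl_act n i x"
proof -
  have "bruhat_act n x (dunkl n i) = (\<Sum>j\<in>{1..n} - {i}. bruhat_act n x (fk_gen n i j))"
    unfolding dunkl_def using assms by (intro bruhat_act_finsum) (auto intro: fk_gen_closed)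
  also have "\<dots> = dunkl_act n i x"
    unfolding dunkl_act_def using assms by (intro sum.cong refl bruhat_act_fk_gen) auto
  finally show ?thesis .
qed

lemma bruhat_act_dunkl_pow:
  assumes "supported n x" "i \<in> {1..n}"
  shows "bruhat_act n x (dunkl n i [^]\<^bsub>FK n\<^esub> (p :: nat)) = (dunkl_act n i ^^ p) x"
proof -
  interpret F: ring "FK n" by (rule ring_FK)
  show ?thesis
    using assms
    by (induction p)
      (simp_all only: F.nat_pow_0 F.nat_pow_Suc bruhat_act_one bruhat_act_mult F.nat_pow_closed
        dunkl_closed bruhat_act_dunkl dunkl.funpow_supported funpow.simps comp_apply id_apply)
qed

text \<open>The leftmost factor acts first, so the \<open>foldr\<close> that forms the product
  becomes a \<open>foldl\<close> of operators.\<close>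

lemma eval_monom_closed: "eval_monom (FK n) n (dunkl n) m \<in> carrier (FK n)"
  and bruhat_act_eval_monom:
    "supported n x \<Longrightarrow> bruhat_act n x (eval_monom (FK n) n (dunkl n) m) = monom_op n (dunkl_act n) m x"
proof -
  interpret F: ring "FK n" by (rule ring_FK)
  let ?E = "\<lambda>is. foldr (\<lambda>i a. (dunkl n i [^]\<^bsub>FK n\<^esub> Poly_Mapping.lookup m i) \<otimes>\<^bsub>FK n\<^esub> a) is \<one>\<^bsub>FK n\<^esub>"
  have closed: "?E js \<in> carrier (FK n)" if "set js \<subseteq> {1..n}" for js
    using that by (induction js) (auto intro!: F.m_closed F.nat_pow_closed dunkl_closed)
  have act: "bruhat_act n x (?E js) = foldl (\<lambda>y i. (dunkl_act n i ^^ Poly_Mapping.lookup m i) y) x js"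
    if "set js \<subseteq> {1..n}" "supported n x" for js x
    using that
  proof (induction js arbitrary: x)
    case Nil
    then show ?case by (simp add: bruhat_act_one)
  next
    case (Cons j js)
    then have j: "j \<in> {1..n}" and js: "set js \<subseteq> {1..n}" by simp_all
    have "bruhat_act n x (?E (j # js)) =
        bruhat_act n (bruhat_act n x (dunkl n j [^]\<^bsub>FK n\<^esub> Poly_Mapping.lookup m j)) (?E js)"
      unfolding foldr.simps comp_apply
      using Cons.prems j closed [OF js] by (intro bruhat_act_mult F.nat_pow_closed dunkl_closed)
    then show ?case
      using Cons.prems j js by (simp add: bruhat_act_dunkl_pow Cons.IH dunkl.funpow_supported)
  qed
  have set: "set [1..<Suc n] \<subseteq> {1..n}" by auto
  show "eval_monom (FK n) n (dunkl n) m \<in> carrier (FK n)"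
    unfolding eval_monom_def by (rule closed [OF set])
  show "bruhat_act n x (eval_monom (FK n) n (dunkl n) m) = monom_op n (dunkl_act n) m x"
    if "supported n x"
    unfolding eval_monom_def monom_op_def by (rule act [OF set that])
qed

lemma bruhat_act_eval_poly:
  assumes "supported n x"
  shows "bruhat_act n x (eval_poly (FK n) n (dunkl n) f) = poly_op n (dunkl_act n) f x"
proof -
  interpret F: ring "FK n" by (rule ring_FK)
  have "bruhat_act n x (eval_poly (FK n) n (dunkl n) f) = (\<Sum>m\<in>Poly_Mapping.keys f.
      bruhat_act n x (add_pow (FK n) (Poly_Mapping.lookup f m) (eval_monom (FK n) n (dunkl n) m)))"
    unfolding eval_poly_def
    using assms by (intro bruhat_act_finsum) (auto intro: F.add.int_pow_closed eval_monom_closed)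
  then show ?thesis
    by (simp add: poly_op_def frag_extend_def assms bruhat_act_add_pow eval_monom_closed
        bruhat_act_eval_monom)
qed

theorem theorem4p1:
  fixes n :: nat and w v :: "nat \<Rightarrow> nat"
  assumes "n \<ge> 2" and "w permutes {1..n}" and "v permutes {1..n}"
  shows "Poly_Mapping.lookup (csm n w) v =
    psi (bruhat_act n (frag_of w) (eval_poly (FK n) n (dunkl n) (schubert n v)))"
  using lookup_csm [OF assms(2,3)] assms(2)
  by (simp add: dunkl_functional_def bruhat_act_eval_poly)

end
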